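(* Let $n\ge2$ be an integer, $1\le p<n$, and let $\alpha,\beta\in\mathbb{R}$ satisfy $\alpha p>1-n$ and $(\alpha+\beta)p>-n$. Then (for the given $n$) there exists some constant $C$, depending on $p$, $\alpha$ and $\beta$, such that for all $u\in C_0^1(\mathbb{R}^n)$ and all $\alpha'\le\alpha$, $$\big\||x|^{\beta}|x'|^{\alpha}u\big\|_{L^p(\mathbb{R}^n)}\le C\,\big\||x|^{\beta+\alpha-\alpha'}|x'|^{\alpha'+1}\nabla u\big\|_{L^p(\mathbb{R}^n)} .$$ Moreover, for any $\alpha'>\alpha$ and any $C>0$, this inequality fails in general, i.e. there is some $u\in C_0^1(\mathbb{R}^n)$ for which it does not hold.
   Context: For $x=(x_1,\dots,x_n)\in\mathbb{R}^n$, $x'=(x_1,\dots,x_{n-1})$. $C_0^1(\mathbb{R}^n)$ is the space of compactly supported $C^1$ functions on $\mathbb{R}^n$. *)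

theory Defs
  imports "HOL-Analysis.Analysis"
begin

text \<open>
  \<open>\<real>\<^sup>n\<close> is \<open>real ^ 'n\<close> with \<open>n = CARD('n)\<close>; the linear order on \<open>'n\<close> says which coordinate is
  the last one. The point \<open>x'\<close> in \<open>\<real>\<^sup>n\<^sup>-\<^sup>1\<close> is identified with \<open>(x', 0)\<close> in \<open>\<real>\<^sup>n\<close>, which has the
  same Euclidean norm.
\<close>

definition drop_last :: "real ^ ('n::{finite,linorder}) \<Rightarrow> real ^ ('n::{finite,linorder})" where
  "drop_last x = (\<chi> i. if i = Max UNIV then 0 else x $ i)"

lemma norm_drop_last: "norm (drop_last x) = sqrt (\<Sum>i\<in>UNIV - {Max UNIV}. (x $ i)\<^sup>2)"
proof -
  have "(\<Sum>i\<in>UNIV. (drop_last x $ i)\<^sup>2) = (\<Sum>i\<in>UNIV - {Max UNIV}. (x $ i)\<^sup>2)"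
    by (rule sum.mono_neutral_cong_right) (auto simp: drop_last_def)
  then show ?thesis
    by (simp add: norm_vec_def L2_set_def)
qed

definition grad :: "(real ^ ('n::finite) \<Rightarrow> real) \<Rightarrow> real ^ ('n::finite) \<Rightarrow> real ^ ('n::finite)" where
  "grad u x = (\<chi> i. frechet_derivative u (at x) (axis i 1))"

lemma gderiv_grad:
  assumes "u differentiable (at x)"
  shows "GDERIV u x :> grad u x"
proof -
  let ?D = "frechet_derivative u (at x)"
  have D: "(u has_derivative ?D) (at x)"
    using assms by (simp add: frechet_derivative_works)
  then have lin: "linear ?D"
    by (rule has_derivative_linear)
  have "?D h = h \<bullet> grad u x" for h
  proof -
    have "?D h = ?D (\<Sum>i\<in>UNIV. h $ i *\<^sub>R axis i 1)"
      using basis_expansion[of h] by (simp add: scalar_mult_eq_scaleR)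
    also have "\<dots> = (\<Sum>i\<in>UNIV. h $ i * ?D (axis i 1))"
      using lin by (simp add: linear_sum linear_scale)
    finally show ?thesis
      by (simp add: inner_vec_def grad_def)
  qed
  then have "?D = (\<lambda>h. h \<bullet> grad u x)" by blast
  with D show ?thesis by (simp add: gderiv_def)
qed

definition C01 :: "(real ^ 'n::finite \<Rightarrow> real) set" where
  "C01 = {u. (\<forall>x. u differentiable (at x)) \<and> continuous_on UNIV (grad u)
           \<and> compact (closure {x. u x \<noteq> 0})}"

text \<open>
  The norm takes values in \<open>[0, \<infinity>]\<close>: a weighted gradient need not be in \<open>L\<^sup>p\<close>, and an inequality
  whose right-hand side is infinite has to count as true.
\<close>

definition Lp_norm :: "real \<Rightarrow> ('a::euclidean_space \<Rightarrow> 'b::real_normed_vector) \<Rightarrow> ennreal" where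
  "Lp_norm p f = (let I = (\<integral>\<^sup>+ x. ennreal (norm (f x) powr p) \<partial>lborel)
                  in if I = \<infinity> then \<infinity> else ennreal (enn2real I powr (1 / p)))"

text \<open>
  The weight \<open>|x|\<^sup>b |x'|\<^sup>a\<close>. Since \<open>0 powr a = 0\<close>, its value where \<open>x' = 0\<close> is \<open>0\<close> for every \<open>a\<close>;
  for \<open>n \<ge> 2\<close> this set is Lebesgue null, so the norms are not affected.
\<close>

definition weight :: "real \<Rightarrow> real \<Rightarrow> real ^ 'n::{finite,linorder} \<Rightarrow> real" where
  "weight b a x = norm x powr b * norm (drop_last x) powr a"

end

theory Submission
  imports Defs
begin

text \<open>
  Since \<open>|x'| \<le> |x|\<close>, the weight on the right grows as \<open>\<alpha>'\<close> decreases, so the inequality only has to be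
  proved for \<open>\<alpha>' = \<alpha>\<close>. Put \<open>a = \<alpha>p\<close>, \<open>b = \<beta>p\<close>, \<open>w = |x|\<^sup>b|x'|\<^sup>a\<close>. For a dilation \<open>x \<mapsto> D\<^sub>t x\<close> one has
  \<open>|u(x)|\<^sup>p \<le> (1 + \<epsilon>)|u(D\<^sub>2 x)|\<^sup>p + C\<^sub>\<epsilon> \<integral>\<^sub>1\<^sup>2 |d/dt u(D\<^sub>t x)|\<^sup>p dt\<close>; integrating this against a weight that
  \<open>D\<^sub>2\<close> transforms with a factor \<open>< 1\<close> allows the first term to be absorbed. With the full dilation and the
  weight \<open>w(|x'|/|x|)\<^sup>p\<close> the factor is \<open>2\<close> to the power \<open>-(a + b + n)\<close>, and the gradient term is the wanted
  one. With the dilation of \<open>x'\<close> alone and the weight \<open>w\<close> itself, the factor is \<open>2\<close> to the power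
  \<open>-(a + n - 1)\<close>, up to a multiple of \<open>w(|x'|/|x|)\<^sup>p\<close>, which is controlled by the first estimate.
  Absorption needs \<open>\<integral> w|u|\<^sup>p < \<infinity>\<close>, which is local integrability of \<open>w\<close>.

  For \<open>\<alpha>' > \<alpha>\<close>, compressing towards the axis \<open>x' = 0\<close> a bump supported away from it makes the quotient of
  the two sides blow up.
\<close>

section \<open>Dilations of some of the coordinates\<close>

lemma powr_add_le_weighted:
  fixes a b l p :: real
  assumes "0 \<le> a" "0 \<le> b" "1 \<le> p" "0 < l" "l < 1"
  shows "(a + b) powr p \<le> (1 - l) powr (1 - p) * a powr p + l powr (1 - p) * b powr p"
proof (cases "a = 0 \<or> b = 0")
  case True
  \<comment> \<open>If one summand vanishes, it is enough that both coefficients are at least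
    1.\<close>
  have 1: "1 \<le> l powr (1 - p)" "1 \<le> (1 - l) powr (1 - p)"
    using powr_mono2'[of "1 - p" l 1] powr_mono2'[of "1 - p" "1 - l" 1] assms by auto
  have "b powr p \<le> l powr (1 - p) * b powr p" "a powr p \<le> (1 - l) powr (1 - p) * a powr p"
    using 1 by (simp_all add: mult_le_cancel_right1)
  then show ?thesis using True assms by auto
next
  case False
  then have ab: "a > 0" "b > 0" using assms by auto
  \<comment> \<open>\<open>a + b\<close> is a convex combination of \<open>a / (1 - l)\<close> and
    \<open>b / l\<close>. The free parameter \<open>l\<close> brings the coefficient of
    \<open>a powr p\<close> as close to 1 as wanted, at the cost of a large coefficient of
    \<open>b powr p\<close>; absorption relies on this.\<close>
  have "((1 - l) *\<^sub>R (a / (1 - l)) + l *\<^sub>R (b / l)) powr p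
      \<le> (1 - l) * (a / (1 - l)) powr p + l * (b / l) powr p"
    using convex_onD[OF powr_convex[OF assms(3)], of l "a / (1 - l)" "b / l"] ab assms by simp
  also have "(1 - l) * (a / (1 - l)) powr p = (1 - l) powr (1 - p) * a powr p"
    using assms ab by (simp add: powr_divide powr_diff)
  also have "l * (b / l) powr p = l powr (1 - p) * b powr p"
    using assms ab by (simp add: powr_divide powr_diff)
  finally show ?thesis using assms by simp
qed

lemma powr_above_tangent:
  fixes x c p :: real
  assumes "0 \<le> x" "0 < c" "1 \<le> p"
  shows "c powr p + p * c powr (p - 1) * (x - c) \<le> x powr p"
proof (cases "x = 0")
  case True
  have "c powr (p - 1) * c = c powr p" using assms by (simp add: powr_diff)
  then have "c powr p + p * c powr (p - 1) * (x - c) = (1 - p) * c powr p"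
    using True by (simp add: algebra_simps)
  also have "\<dots> \<le> 0" using assms by (simp add: mult_nonpos_nonneg)
  finally show ?thesis using True by simp
next
  case False
  have "p * c powr (p - 1) * (x - c) \<le> x powr p - c powr p"
    by (rule convex_on_imp_above_tangent[OF powr_convex[OF assms(3)]])
      (use assms False in \<open>auto simp: interior_open intro!: derivative_eq_intros\<close>)
  then show ?thesis by simp
qed

text \<open>Jensen's inequality: the tangent line of the p-th power at the mean \<open>c\<close> of
  \<open>f\<close> is integrated, and its linear term integrates to 0. No constant appears because
  the interval has length 1.\<close>

lemma powr_integral_le:
  fixes f :: "real \<Rightarrow> real"
  assumes f: "continuous_on {1..2} f" and nn: "\<And>t. t \<in> {1..2} \<Longrightarrow> 0 \<le> f t" and p: "1 \<le> p"
  shows "(integral {1..2} f) powr p \<le> integral {1..2} (\<lambda>t. f t powr p)"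
proof -
  define c where "c = integral {1..2} f"
  have fi: "(f has_integral c) {1..2}"
    unfolding c_def using f by (intro integrable_integral integrable_continuous_interval)
  have pi: "(\<lambda>t. f t powr p) integrable_on {1..2}"
    using f nn p by (intro integrable_continuous_interval continuous_on_powr' continuous_intros) auto
  have c0: "0 \<le> c" unfolding c_def using nn by (intro integral_nonneg) (use fi in auto)
  show ?thesis
  proof (cases "c = 0")
    case True
    have "0 \<le> integral {1..2} (\<lambda>t. f t powr p)" using pi by (intro integral_nonneg) auto
    then show ?thesis using True p by (simp add: c_def)
  next
    case False
    have "((\<lambda>t. c powr p + p * c powr (p - 1) * (f t - c)) has_integral
        (2 - 1) *\<^sub>R c powr p + p * c powr (p - 1) * (c - (2 - 1) *\<^sub>R c)) {1..2}"
      using fi by (intro has_integral_add has_integral_mult_right has_integral_diff)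
        (use has_integral_const_real[of _ 1 2] in auto)
    then have "c powr p \<le> integral {1..2} (\<lambda>t. f t powr p)"
      using powr_above_tangent[OF nn _ p, of _ c] False c0
      by (intro has_integral_le[OF _ integrable_integral[OF pi]]) auto
    then show ?thesis by (simp add: c_def)
  qed
qed

section \<open>Partial dilations, and their effect on functions and integrals\<close>

definition dil :: "'n set \<Rightarrow> real \<Rightarrow> real ^ 'n::finite \<Rightarrow> real ^ 'n" where
  "dil S t x = (\<chi> i. if i \<in> S then t * x $ i else x $ i)"

text \<open>The constant velocity of the affine curve that sends \<open>t\<close> to
  \<open>dil S t x\<close>. Two sets matter later: \<open>UNIV\<close>, where \<open>dil\<close> is
  the full dilation, and \<open>- {Max UNIV}\<close>, where \<open>dil\<close> scales x' alone and
  \<open>restr\<close> is \<open>drop_last\<close>.\<close>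

definition restr :: "'n set \<Rightarrow> real ^ 'n::finite \<Rightarrow> real ^ 'n" where
  "restr S x = (\<chi> i. if i \<in> S then x $ i else 0)"

lemma dil_eq: "dil S t x = x + (t - 1) *\<^sub>R restr S x"
  by (simp add: dil_def restr_def vec_eq_iff algebra_simps)

lemma dil_1 [simp]: "dil S 1 x = x"
  by (simp add: dil_eq)

lemma dil_dil [simp]: "dil S s (dil S t x) = dil S (s * t) x"
  by (simp add: dil_def vec_eq_iff)

lemma restr_dil: "restr S (dil S t x) = t *\<^sub>R restr S x"
  by (simp add: dil_def restr_def vec_eq_iff)

lemma bounded_linear_restr: "bounded_linear (restr S)"
  unfolding linear_conv_bounded_linear[symmetric]
  by (auto simp: restr_def linear_iff vec_eq_iff)

lemmas continuous_on_restr [continuous_intros] = bounded_linear.continuous_on[OF bounded_linear_restr]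

lemma borel_measurable_restr [measurable]: "restr S \<in> borel_measurable borel"
  by (intro borel_measurable_continuous_onI continuous_intros)

lemma continuous_on_dil [continuous_intros]:
  "continuous_on A f \<Longrightarrow> continuous_on A g \<Longrightarrow> continuous_on A (\<lambda>x. dil S (f x) (g x))"
  unfolding dil_eq by (intro continuous_intros)

lemma borel_measurable_dil [measurable]: "dil S t \<in> borel_measurable borel"
  by (intro borel_measurable_continuous_onI continuous_intros)

lemma C01_deriv_dil:
  assumes "u \<in> C01"
  shows "((\<lambda>t. u (dil S t x)) has_real_derivative (restr S x \<bullet> grad u (dil S t x))) (at t within A)"
proof -
  have "(u has_derivative (\<lambda>h. h \<bullet> grad u (dil S t x))) (at (dil S t x))"
    using gderiv_grad[of u "dil S t x"] assms by (simp add: C01_def gderiv_def)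
  moreover have "((\<lambda>t. dil S t x) has_vector_derivative restr S x) (at t within A)"
    unfolding dil_eq by (auto intro!: derivative_eq_intros)
  ultimately have "((u \<circ> (\<lambda>t. dil S t x)) has_vector_derivative (restr S x \<bullet> grad u (dil S t x))) (at t within A)"
    by (rule vector_derivative_diff_chain_within[OF _ has_derivative_at_withinI, rotated])
  then show ?thesis by (simp add: has_real_derivative_iff_has_vector_derivative o_def)
qed

lemma C01_continuous:
  assumes "u \<in> C01"
  shows "continuous_on UNIV u" "continuous_on UNIV (grad u)"
  using assms unfolding C01_def
  by (auto intro!: differentiable_imp_continuous_on simp: differentiable_on_def)

lemma C01_measurable:
  assumes "u \<in> C01"
  shows "u \<in> borel_measurable borel" "grad u \<in> borel_measurable borel"
  using C01_continuous[OF assms] by (auto intro: borel_measurable_continuous_onI)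

text \<open>The fundamental theorem of calculus along the curve from \<open>x\<close> to
  \<open>dil S 2 x\<close>, with Cauchy-Schwarz for the derivative, bounds the difference of the two
  values by an integral over t; \<open>powr_add_le_weighted\<close> and Jensen's inequality then
  handle the p-th power. The last term is a nonnegative integral so that the order of integration
  can be exchanged afterwards.\<close>

lemma C01_dil_le:
  assumes u: "u \<in> C01" and p: "1 \<le> p" and l: "0 < l" "l < 1"
  shows "ennreal (\<bar>u x\<bar> powr p) \<le> ennreal ((1 - l) powr (1 - p)) * ennreal (\<bar>u (dil S 2 x)\<bar> powr p) +
    ennreal (l powr (1 - p)) *
      (\<integral>\<^sup>+t. ennreal ((norm (restr S x) * norm (grad u (dil S t x))) powr p) * indicator {1..2} t \<partial>lborel)"
proof -
  define f where "f t = norm (restr S x) * norm (grad u (dil S t x))" for t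
  have f: "continuous_on {1..2} f"
    unfolding f_def
    by (intro continuous_intros continuous_on_compose2[OF C01_continuous(2)[OF u]]) auto
  have D: "((\<lambda>t. restr S x \<bullet> grad u (dil S t x)) has_integral u (dil S 2 x) - u (dil S 1 x)) {1..2}"
    using C01_deriv_dil[OF u]
    by (intro fundamental_theorem_of_calculus)
      (auto simp: has_real_derivative_iff_has_vector_derivative[symmetric])
  from D have "norm (integral {1..2} (\<lambda>t. restr S x \<bullet> grad u (dil S t x))) \<le> integral {1..2} f"
    using f by (intro integral_norm_bound_integral)
      (auto simp: f_def Cauchy_Schwarz_ineq2 intro: integrable_continuous_interval)
  moreover have "integral {1..2} (\<lambda>t. restr S x \<bullet> grad u (dil S t x)) = u (dil S 2 x) - u x"
    using D by (simp add: integral_unique)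
  ultimately have "\<bar>u x\<bar> \<le> \<bar>u (dil S 2 x)\<bar> + integral {1..2} f" by simp
  then have "\<bar>u x\<bar> powr p \<le> (\<bar>u (dil S 2 x)\<bar> + integral {1..2} f) powr p"
    using p by (intro powr_mono2) auto
  also have "\<dots> \<le> (1 - l) powr (1 - p) * \<bar>u (dil S 2 x)\<bar> powr p +
      l powr (1 - p) * (integral {1..2} f) powr p"
    using f p l by (intro powr_add_le_weighted integral_nonneg integrable_continuous_interval)
      (auto simp: f_def)
  also have "\<dots> \<le> (1 - l) powr (1 - p) * \<bar>u (dil S 2 x)\<bar> powr p +
      l powr (1 - p) * integral {1..2} (\<lambda>t. f t powr p)"
    using f p by (intro add_left_mono mult_left_mono powr_integral_le) (auto simp: f_def)
  finally have "\<bar>u x\<bar> powr p \<le> (1 - l) powr (1 - p) * \<bar>u (dil S 2 x)\<bar> powr p +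
      l powr (1 - p) * integral {1..2} (\<lambda>t. f t powr p)" .
  moreover have pi: "(\<lambda>t. f t powr p) integrable_on {1..2}"
    using f p
    by (intro integrable_continuous_interval continuous_on_powr' continuous_intros) (auto simp: f_def)
  then have "(\<integral>\<^sup>+t. ennreal (f t powr p) * indicator {1..2} t \<partial>lborel) =
      ennreal (integral {1..2} (\<lambda>t. f t powr p))"
    by (intro nn_integral_has_integral_lebesgue' integrable_integral) auto
  moreover have "0 \<le> integral {1..2} (\<lambda>t. f t powr p)"
    using pi by (intro integral_nonneg) auto
  ultimately show ?thesis
    by (simp add: f_def ennreal_mult[symmetric] ennreal_plus[symmetric] del: ennreal_plus)
qed

lemma Basis_vec_eq: "(Basis :: (real ^ 'n::finite) set) = range (\<lambda>i. axis i 1)"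
  by (auto simp: Basis_vec_def)

text \<open>\<open>dil S t\<close> is a diagonal linear map with determinant
  \<open>t ^ card S\<close>.\<close>

lemma nn_integral_dil:
  fixes f :: "real ^ 'n::finite \<Rightarrow> ennreal"
  assumes [measurable]: "f \<in> borel_measurable borel" and t: "0 < t"
  shows "(\<integral>\<^sup>+x. f (dil S t x) \<partial>lborel) = ennreal (1 / t ^ card S) * (\<integral>\<^sup>+x. f x \<partial>lborel)"
proof -
  \<comment> \<open>The diagonal entries, indexed by basis vectors instead of coordinates, as the
    change of variables over \<open>Basis\<close> requires.\<close>
  define c :: "real ^ 'n \<Rightarrow> real" where "c j = (if j \<in> (\<lambda>i. axis i 1) ` S then t else 1)" for j
  have inj: "inj (\<lambda>i::'n. axis i (1::real))" by (auto simp: inj_on_def axis_eq_axis)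
  have c_axis: "c (axis i 1) = (if i \<in> S then t else 1)" for i
    by (auto simp: c_def axis_eq_axis)
  have ax: "axis i (1::real) $ k = (if i = k then 1 else 0)" for i k :: 'n
    by (auto simp: axis_def)
  have T: "dil S t x = 0 + (\<Sum>j\<in>Basis. (c j * (x \<bullet> j)) *\<^sub>R j)" for x
    unfolding Basis_vec_eq
    by (subst sum.reindex[OF inj])
      (simp add: vec_eq_iff dil_def c_axis ax inner_axis o_def if_distrib[where f="\<lambda>z. _ * z"] cong: if_cong)
  have "(\<Prod>j\<in>Basis. \<bar>c j\<bar>) = (\<Prod>i\<in>UNIV. if i \<in> S then t else 1)"
    unfolding Basis_vec_eq using t by (subst prod.reindex[OF inj]) (auto simp: c_axis intro!: prod.cong)
  also have "\<dots> = t ^ card S" by (simp add: prod.If_cases)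
  finally have P: "(\<Prod>j\<in>Basis. \<bar>c j\<bar>) = t ^ card S" .
  have "(\<integral>\<^sup>+x. f x \<partial>lborel) =
      (\<integral>\<^sup>+x. f x \<partial>density (distr lborel borel (dil S t)) (\<lambda>_. \<Prod>j\<in>Basis. \<bar>c j\<bar>))"
    unfolding T[abs_def] using t by (subst lborel_affine_euclidean[of c 0]) (auto simp: c_def)
  also have "\<dots> = ennreal (t ^ card S) * (\<integral>\<^sup>+x. f (dil S t x) \<partial>lborel)"
    by (simp add: P nn_integral_density nn_integral_distr nn_integral_cmult)
  finally show ?thesis
    using t by (simp add: mult.assoc[symmetric] ennreal_mult[symmetric])
qed

text \<open>\<open>C01_dil_le\<close> is integrated against \<open>W\<close>, and every dilation is
  moved from \<open>u\<close> to the weights by substitution. The first term picks up the Jacobian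
  \<open>1 / 2 ^ card S\<close>, which is the source of the small factor in both later estimates. In
  the gradient term, \<open>V\<close> dominates the transformed weight for all t between 1 and 2 at
  once.\<close>

lemma weighted_dil_inequality:
  fixes u :: "real ^ 'n::finite \<Rightarrow> real"
  assumes u: "u \<in> C01" and p: "1 \<le> p" and l: "0 < l" "l < 1"
    and [measurable]: "W \<in> borel_measurable borel" "V \<in> borel_measurable borel"
    and W: "\<And>x. 0 \<le> W x"
    and V: "\<And>t x. 1 \<le> t \<Longrightarrow> t \<le> 2 \<Longrightarrow> W (dil S (1 / t) x) * norm (restr S (dil S (1 / t) x)) powr p \<le> V x"
  shows "(\<integral>\<^sup>+x. ennreal (W x * \<bar>u x\<bar> powr p) \<partial>lborel) \<le>
    ennreal ((1 - l) powr (1 - p) / 2 ^ card S) * (\<integral>\<^sup>+x. ennreal (W (dil S (1 / 2) x) * \<bar>u x\<bar> powr p) \<partial>lborel) +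
    ennreal (l powr (1 - p)) * (\<integral>\<^sup>+x. ennreal (V x * norm (grad u x) powr p) \<partial>lborel)"
proof -
  note [measurable] = C01_measurable[OF u]
  define A where "A = (1 - l) powr (1 - p)"
  define B where "B = l powr (1 - p)"
  define G where "G t x = (norm (restr S x) * norm (grad u (dil S t x))) powr p" for t x
  have AB: "0 \<le> A" "0 \<le> B" by (auto simp: A_def B_def)
  \<comment> \<open>Joint measurability in t and x, needed to exchange the two integrals.\<close>
  have Gm [measurable]: "(\<lambda>z. G (f z) (g z)) \<in> borel_measurable M"
    if [measurable]: "f \<in> borel_measurable M" "g \<in> borel_measurable M" for f g and M :: "'z measure"
    unfolding G_def dil_eq by measurable
  have "(\<integral>\<^sup>+x. ennreal (W x * \<bar>u x\<bar> powr p) \<partial>lborel) \<le>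
      (\<integral>\<^sup>+x. (ennreal A * ennreal (W x * \<bar>u (dil S 2 x)\<bar> powr p) +
        ennreal B * (\<integral>\<^sup>+t. ennreal (W x * G t x) * indicator {1..2} t \<partial>lborel)) \<partial>lborel)"
  proof (intro nn_integral_mono)
    fix x
    have "ennreal (W x * \<bar>u x\<bar> powr p) \<le> ennreal (W x) * (ennreal A * ennreal (\<bar>u (dil S 2 x)\<bar> powr p) +
      ennreal B * (\<integral>\<^sup>+t. ennreal (G t x) * indicator {1..2} t \<partial>lborel))"
      unfolding ennreal_mult'[OF W] A_def B_def G_def
      by (intro mult_left_mono C01_dil_le[OF u p l]) simp
    also have "\<dots> = ennreal A * ennreal (W x * \<bar>u (dil S 2 x)\<bar> powr p) +
        ennreal B * (ennreal (W x) * (\<integral>\<^sup>+t. ennreal (G t x) * indicator {1..2} t \<partial>lborel))"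
      using W by (simp add: ennreal_mult' distrib_left ac_simps)
    also have "ennreal (W x) * (\<integral>\<^sup>+t. ennreal (G t x) * indicator {1..2} t \<partial>lborel) =
        (\<integral>\<^sup>+t. ennreal (W x * G t x) * indicator {1..2} t \<partial>lborel)"
      using W by (subst nn_integral_cmult[symmetric]) (auto simp: ennreal_mult' ac_simps)
    finally show "ennreal (W x * \<bar>u x\<bar> powr p) \<le> ennreal A * ennreal (W x * \<bar>u (dil S 2 x)\<bar> powr p) +
        ennreal B * (\<integral>\<^sup>+t. ennreal (W x * G t x) * indicator {1..2} t \<partial>lborel)" .
  qed
  also have "\<dots> = ennreal A * (\<integral>\<^sup>+x. ennreal (W x * \<bar>u (dil S 2 x)\<bar> powr p) \<partial>lborel) +
      ennreal B * (\<integral>\<^sup>+x. (\<integral>\<^sup>+t. ennreal (W x * G t x) * indicator {1..2} t \<partial>lborel) \<partial>lborel)"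
    by (simp add: nn_integral_add nn_integral_cmult)
  also have "(\<integral>\<^sup>+x. ennreal (W x * \<bar>u (dil S 2 x)\<bar> powr p) \<partial>lborel) =
      ennreal (1 / 2 ^ card S) * (\<integral>\<^sup>+x. ennreal (W (dil S (1 / 2) x) * \<bar>u x\<bar> powr p) \<partial>lborel)"
    using nn_integral_dil[of "\<lambda>x. ennreal (W (dil S (1 / 2) x) * \<bar>u x\<bar> powr p)" 2 S] by simp
  also have "(\<integral>\<^sup>+x. (\<integral>\<^sup>+t. ennreal (W x * G t x) * indicator {1..2} t \<partial>lborel) \<partial>lborel) =
      (\<integral>\<^sup>+t. (\<integral>\<^sup>+x. ennreal (W x * G t x) * indicator {1..2} t \<partial>lborel) \<partial>lborel)"
    by (rule lborel_pair.Fubini') measurable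
  \<comment> \<open>The inner integral has a bound independent of t, and t runs over an interval of
    length 1.\<close>
  also have "\<dots> \<le> (\<integral>\<^sup>+t. (\<integral>\<^sup>+x. ennreal (V x * norm (grad u x) powr p) \<partial>lborel) * indicator {1..2} (t::real) \<partial>lborel)"
  proof (intro nn_integral_mono)
    fix t :: real
    have "(\<integral>\<^sup>+x. ennreal (W x * G t x) \<partial>lborel) \<le> (\<integral>\<^sup>+x. ennreal (V x * norm (grad u x) powr p) \<partial>lborel)"
      if t: "1 \<le> t" "t \<le> 2"
    proof -
      \<comment> \<open>\<open>dil S (1 / t)\<close> undoes \<open>dil S t\<close>, so the integrand
        is \<open>?f\<close> at \<open>dil S t x\<close>. The Jacobian \<open>1 / t ^ card S\<close>
        of the substitution is at most 1.\<close>
      let ?f = "\<lambda>x. W (dil S (1 / t) x) * norm (restr S (dil S (1 / t) x)) powr p * norm (grad u x) powr p"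
      have "(\<integral>\<^sup>+x. ennreal (W x * G t x) \<partial>lborel) = (\<integral>\<^sup>+x. ennreal (?f (dil S t x)) \<partial>lborel)"
        using t by (intro nn_integral_cong) (simp add: G_def powr_mult mult.assoc)
      also have "\<dots> = ennreal (1 / t ^ card S) * (\<integral>\<^sup>+x. ennreal (?f x) \<partial>lborel)"
        using t by (intro nn_integral_dil) auto
      also have "\<dots> \<le> 1 * (\<integral>\<^sup>+x. ennreal (V x * norm (grad u x) powr p) \<partial>lborel)"
        using t V[OF t] by (intro mult_mono nn_integral_mono ennreal_leI mult_right_mono) auto
      finally show ?thesis by simp
    qed
    then show "(\<integral>\<^sup>+x. ennreal (W x * G t x) * indicator {1..2} t \<partial>lborel) \<le>
      (\<integral>\<^sup>+x. ennreal (V x * norm (grad u x) powr p) \<partial>lborel) * indicator {1..2} t"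
      by (cases "t \<in> {1..2}") auto
  qed
  also have "\<dots> = (\<integral>\<^sup>+x. ennreal (V x * norm (grad u x) powr p) \<partial>lborel)"
    by (subst nn_integral_cmult) auto
  finally show ?thesis
    using AB by (simp add: A_def B_def ennreal_mult[symmetric] mult.assoc[symmetric] add_left_mono mult_left_mono)
qed

section \<open>Local integrability of the weights\<close>

lemma drop_last_restr: "drop_last = restr (- {Max UNIV})"
  by (auto simp: drop_last_def restr_def vec_eq_iff)

lemma norm_restr_le: "norm (restr S x) \<le> norm x"
  by (rule norm_le_componentwise_cart) (simp add: restr_def)

lemma norm_drop_last_le: "norm (drop_last x) \<le> norm x"
  unfolding drop_last_restr by (rule norm_restr_le)

lemma weight_nonneg [simp]: "0 \<le> weight b a x"
  by (simp add: weight_def)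

lemma borel_measurable_weight [measurable]: "weight b a \<in> borel_measurable borel"
  unfolding weight_def[abs_def] drop_last_restr by measurable

text \<open>Bounds by products of negative powers of the coordinates can fail where a coordinate
  vanishes, since \<open>0 powr g = 0\<close>; these points form a null set.\<close>

lemma AE_lborel_component_nonzero: "AE x in lborel. \<forall>i::'n::finite. (x :: real ^ 'n) $ i \<noteq> 0"
proof -
  have "AE x in lborel. (x :: real ^ 'n) $ i \<noteq> 0" for i :: 'n
  proof -
    have "{x :: real ^ 'n. x $ i = 0} \<in> null_sets lebesgue"
      using negligible_standard_hyperplane_cart[of i] by (simp add: negligible_iff_null_sets)
    moreover have "{x :: real ^ 'n. x $ i = 0} \<in> sets lborel" by simp
    ultimately have "{x :: real ^ 'n. x $ i = 0} \<in> null_sets lborel"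
      by (simp add: null_sets_completion_iff)
    then show ?thesis using AE_not_in by fastforce
  qed
  then show ?thesis by (simp add: eventually_all_finite)
qed

lemma nn_integral_abs_powr_finite:
  assumes g: "-1 < g" and M: "0 \<le> M"
  shows "(\<integral>\<^sup>+t. ennreal (\<bar>t\<bar> powr g) * indicator {-M..M} t \<partial>lborel) < \<infinity>"
proof -
  have 1: "((\<lambda>t. \<bar>t\<bar> powr g) has_integral (M powr (g + 1) / (g + 1))) {0..M}"
    using has_integral_powr_from_0[OF g M] by (rule has_integral_eq[rotated]) auto
  then have 2: "((\<lambda>t. \<bar>t\<bar> powr g) has_integral (M powr (g + 1) / (g + 1))) {-M..0}"
    using has_integral_reflect_real[of "\<lambda>t. \<bar>t\<bar> powr g" _ M 0] by simp
  have "((\<lambda>t. \<bar>t\<bar> powr g) has_integral (M powr (g + 1) / (g + 1) + M powr (g + 1) / (g + 1))) {-M..M}"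
    using M by (intro has_integral_combine[OF _ _ 2 1]) auto
  then show ?thesis
    by (subst nn_integral_has_integral_lebesgue') auto
qed

text \<open>\<open>r powr e\<close> is split into \<open>card S\<close> equal factors. As the
  exponent is not positive, each factor can only grow when \<open>r\<close> is replaced by a smaller
  \<open>\<bar>x i\<bar>\<close>.\<close>

lemma powr_le_prod_powr:
  fixes x :: "'i \<Rightarrow> real"
  assumes "finite S" "S \<noteq> {}" "e \<le> 0" and "\<And>i. i \<in> S \<Longrightarrow> x i \<noteq> 0 \<and> \<bar>x i\<bar> \<le> r"
  shows "r powr e \<le> (\<Prod>i\<in>S. \<bar>x i\<bar> powr (e / card S))"
proof -
  obtain i where "i \<in> S" using assms by auto
  then have r: "0 < r" using assms(4)[of i] by auto
  have c: "card S \<noteq> 0" using assms by auto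
  have "r powr e = (r powr (e / card S)) ^ card S"
    using r c by (simp add: powr_realpow[symmetric] powr_powr)
  also have "\<dots> = (\<Prod>i\<in>S. r powr (e / card S))" by simp
  also have "\<dots> \<le> (\<Prod>i\<in>S. \<bar>x i\<bar> powr (e / card S))"
    using assms by (intro prod_mono conjI powr_mono2') (auto simp: divide_nonpos_nonneg)
  finally show ?thesis .
qed

text \<open>
  The factor \<open>|x|\<^sup>b\<close> is split as \<open>|x|\<close> to the powers \<open>-c\<close> and \<open>b + c\<close>, bounded by powers of the last
  coordinate and of \<open>|x'|\<close> respectively; the hypotheses on \<open>a\<close> and \<open>b\<close> are what makes room for a \<open>c\<close> for
  which both resulting exponents are integrable at \<open>0\<close>.
\<close>

lemma weight_le_prod:
  assumes n: "2 \<le> CARD('n::{finite,linorder})" and ab: "a \<le> 0" "b \<le> 0"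
    and a: "1 - real CARD('n::{finite,linorder}) < a" and b: "- real CARD('n::{finite,linorder}) < a + b"
  obtains g :: "'n::{finite,linorder} \<Rightarrow> real" where "\<And>i. -1 < g i"
    and "\<And>x :: real ^ ('n::{finite,linorder}). (\<forall>i. x $ i \<noteq> 0) \<Longrightarrow> weight b a x \<le> (\<Prod>i\<in>UNIV. \<bar>x $ i\<bar> powr g i)"
proof -
  define m where "m = real CARD('n) - 1"
  \<comment> \<open>The conditions on \<open>c\<close> are \<open>0 \<le> c < 1\<close>,
    \<open>c \<le> - b\<close> and \<open>- m < a + b + c\<close>. They place \<open>c\<close>
    between \<open>L\<close> and \<open>U\<close>, and the midpoint also meets the strict ones. For
    \<open>b = 0\<close> both ends are 0, and the last condition is the hypothesis on
    \<open>a\<close>.\<close>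
  define L where "L = max 0 (-(a + b) - m)"
  define U where "U = min 1 (- b)"
  define c where "c = (L + U) / 2"
  have m: "1 \<le> m" using n by (simp add: m_def)
  have card: "real (card (- {Max UNIV} :: 'n set)) = m"
    using n by (simp add: m_def Compl_eq_Diff_UNIV card_Diff_singleton of_nat_diff)
  have c: "0 \<le> c" "c < 1" "c \<le> - b" "- m < a + b + c"
    using a b ab by (auto simp: c_def L_def U_def m_def max_def min_def field_simps)
  \<comment> \<open>The last coordinate takes the exponent \<open>- c\<close>; the other
    \<open>m\<close> coordinates share \<open>a + b + c\<close> equally.\<close>
  define g where "g i = (if i = Max UNIV then - c else (a + b + c) / m)" for i :: 'n
  show ?thesis
  proof
    show "-1 < g i" for i
      using c m by (auto simp: g_def field_simps)
  next
    fix x :: "(real, 'n) vec"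
    assume x: "\<forall>i. x $ i \<noteq> 0"
    define i where "i = (Max UNIV :: 'n)"
    have S: "- {i} \<noteq> {}"
      using m card unfolding i_def by (metis card.empty not_one_le_zero of_nat_0 of_nat_le_0_iff order.trans linorder_not_le zero_less_one of_nat_0_less_iff)
    have r: "\<bar>x $ j\<bar> \<le> norm (drop_last x)" if "j \<in> - {i}" for j
      using component_le_norm_cart[of "drop_last x" j] that by (simp add: drop_last_def i_def)
    obtain j where j: "j \<in> - {i}" using S by auto
    have r0: "0 < norm (drop_last x)" using r[OF j] x by (smt (verit))
    have "weight b a x = norm x powr (- c) * norm x powr (b + c) * norm (drop_last x) powr a"
      by (simp add: weight_def powr_add[symmetric])
    also have "\<dots> \<le> \<bar>x $ i\<bar> powr (- c) * norm (drop_last x) powr (b + c) * norm (drop_last x) powr a"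
      using c x r0 norm_drop_last_le[of x]
      by (intro mult_right_mono[OF mult_mono] powr_mono2' component_le_norm_cart) auto
    also have "\<dots> = \<bar>x $ i\<bar> powr (- c) * norm (drop_last x) powr (a + b + c)"
      by (simp add: powr_add ac_simps)
    also have "\<dots> \<le> \<bar>x $ i\<bar> powr (- c) * (\<Prod>j\<in>- {i}. \<bar>x $ j\<bar> powr ((a + b + c) / card (- {i})))"
      using S x r c ab by (intro mult_left_mono powr_le_prod_powr) auto
    also have "(\<Prod>j\<in>- {i}. \<bar>x $ j\<bar> powr ((a + b + c) / card (- {i}))) = (\<Prod>j\<in>- {i}. \<bar>x $ j\<bar> powr g j)"
      by (intro prod.cong) (auto simp: g_def i_def card)
    also have "\<bar>x $ i\<bar> powr (- c) * (\<Prod>j\<in>- {i}. \<bar>x $ j\<bar> powr g j) = (\<Prod>j\<in>UNIV. \<bar>x $ j\<bar> powr g j)"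
      by (subst prod.remove[of UNIV i]) (auto simp: g_def i_def Compl_eq_Diff_UNIV)
    finally show "weight b a x \<le> (\<Prod>j\<in>UNIV. \<bar>x $ j\<bar> powr g j)" .
  qed
qed

text \<open>On a ball, lowering \<open>a\<close> and the sum \<open>a + b\<close> costs only a
  constant: \<open>norm (drop_last x) \<le> norm x\<close> turns the surplus power of |x'| into a
  power of |x|, and the surplus power of |x| is bounded by a power of \<open>N\<close>.\<close>

lemma weight_reduce_nonpos:
  assumes n: "2 \<le> CARD('n::{finite,linorder})"
    and a: "1 - real CARD('n::{finite,linorder}) < a" and b: "- real CARD('n::{finite,linorder}) < a + b"
  obtains a' b' K where "a' \<le> 0" "b' \<le> 0" "1 - real CARD('n::{finite,linorder}) < a'" "- real CARD('n::{finite,linorder}) < a' + b'" "0 \<le> K"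
    and "\<And>x :: real ^ ('n::{finite,linorder}). norm x \<le> N \<Longrightarrow> weight b a x \<le> K * weight b' a' x"
proof -
  have *: "weight b a x \<le> N powr (a + b - a' - b') * weight b' a' x"
    if "a' \<le> a" "a' + b' \<le> a + b" "norm x \<le> N" for x :: "(real, 'n) vec" and a' b'
  proof (cases "drop_last x = 0")
    case True
    then show ?thesis by (simp add: weight_def)
  next
    case False
    define R r where "R = norm x" and "r = norm (drop_last x)"
    have r: "0 < r" "r \<le> R" using False norm_drop_last_le[of x] by (auto simp: r_def R_def)
    have "weight b a x = R powr b * (r powr a' * r powr (a - a'))"
      by (simp add: weight_def R_def r_def powr_add[symmetric])
    also have "\<dots> \<le> R powr b * (r powr a' * R powr (a - a'))"
      using r that by (intro mult_left_mono powr_mono2) auto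
    also have "\<dots> = R powr (a + b - a' - b') * (R powr b' * r powr a')"
    proof -
      have "R powr b * R powr (a - a') = R powr (a + b - a' - b') * R powr b'"
        by (simp add: powr_add[symmetric] algebra_simps)
      then show ?thesis by (simp add: ac_simps)
    qed
    also have "\<dots> \<le> N powr (a + b - a' - b') * (R powr b' * r powr a')"
      using r that by (intro mult_right_mono powr_mono2) (auto simp: R_def)
    finally show ?thesis by (simp add: weight_def R_def r_def)
  qed
  show ?thesis
  \<comment> \<open>In both cases the new exponents are not positive and keep the two strict lower
    bounds.\<close>
  proof (cases "0 \<le> a")
    case True
    show ?thesis
      by (rule that[of 0 "min (a + b) 0" "N powr (a + b - 0 - min (a + b) 0)"])
        (use * [of 0 "min (a + b) 0"] True b n in auto)
  next
    case False
    show ?thesis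
      by (rule that[of a "min b 0" "N powr (a + b - a - min b 0)"])
        (use * [of a "min b 0"] False a b n in auto)
  qed
qed

text \<open>After reduction to nonpositive exponents, the weight is dominated almost everywhere by a
  product of one-variable powers, so the integral is bounded by a product of finite one-dimensional
  integrals.\<close>

lemma weight_integrable_cube:
  assumes n: "2 \<le> CARD('n::{finite,linorder})"
    and a: "1 - real CARD('n) < a" and b: "- real CARD('n) < a + b"
    and M: "0 \<le> M"
  shows "(\<integral>\<^sup>+x. ennreal (weight b a x) * (\<Prod>i\<in>UNIV. indicator {-M..M} ((x :: real ^ ('n::{finite,linorder})) $ i)) \<partial>lborel) < \<infinity>"
proof -
  obtain a' b' K where r: "a' \<le> 0" "b' \<le> 0" "1 - real CARD('n) < a'" "- real CARD('n) < a' + b'" "0 \<le> K"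
    and K: "\<And>x :: (real, 'n) vec. norm x \<le> real CARD('n) * M \<Longrightarrow> weight b a x \<le> K * weight b' a' x"
    using weight_reduce_nonpos[OF n a b] by metis
  obtain g :: "'n \<Rightarrow> real" where g: "\<And>i. -1 < g i"
    and le: "\<And>x :: (real, 'n) vec. (\<forall>i. x $ i \<noteq> 0) \<Longrightarrow> weight b' a' x \<le> (\<Prod>i\<in>UNIV. \<bar>x $ i\<bar> powr g i)"
    using weight_le_prod[OF n r(1-4)] by metis
  have inj: "inj (\<lambda>i::'n. axis i (1::real))" by (auto simp: inj_on_def axis_eq_axis)
  \<comment> \<open>\<open>h\<close> carries the exponents over from coordinates to basis vectors,
    because the product formula for integrals runs over \<open>Basis\<close>.\<close>
  define h where "h j = g (inv (\<lambda>i. axis i 1) j)" for j :: "(real, 'n) vec"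
  have h: "h (axis i 1) = g i" for i
    unfolding h_def by (rule arg_cong[OF inv_f_f[OF inj]])
  have "(\<integral>\<^sup>+x. ennreal (weight b a x) * (\<Prod>i\<in>UNIV. indicator {-M..M} ((x :: (real, 'n) vec) $ i)) \<partial>lborel) \<le>
      (\<integral>\<^sup>+x. ennreal K * (\<Prod>i\<in>UNIV. ennreal (\<bar>x $ i\<bar> powr g i) * indicator {-M..M} ((x :: (real, 'n) vec) $ i)) \<partial>lborel)"
  proof (rule nn_integral_mono_AE, rule AE_mp[OF AE_lborel_component_nonzero], rule AE_I2, rule impI)
    fix x :: "(real, 'n) vec"
    assume x: "\<forall>i. x $ i \<noteq> 0"
    show "ennreal (weight b a x) * (\<Prod>i\<in>UNIV. indicator {-M..M} ((x :: (real, 'n) vec) $ i)) \<le>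
      ennreal K * (\<Prod>i\<in>UNIV. ennreal (\<bar>x $ i\<bar> powr g i) * indicator {-M..M} ((x :: (real, 'n) vec) $ i))"
    proof (cases "\<forall>i. x $ i \<in> {-M..M}")
      case True
      have "norm x \<le> (\<Sum>i\<in>UNIV. \<bar>x $ i\<bar>)" by (rule norm_le_l1_cart)
      also have "\<dots> \<le> (\<Sum>i\<in>(UNIV :: 'n set). M)" using True by (intro sum_mono) (auto simp: abs_le_iff minus_le_iff)
      finally have "weight b a x \<le> K * weight b' a' x" by (intro K) simp
      also have "\<dots> \<le> K * (\<Prod>i\<in>UNIV. \<bar>x $ i\<bar> powr g i)" using le x r by (intro mult_left_mono) auto
      finally show ?thesis
        using True r by (simp add: prod.distrib prod_ennreal ennreal_mult[symmetric] prod_nonneg del: atLeastAtMost_iff)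
    next
      case False
      then obtain i where "x $ i \<notin> {-M..M}" by auto
      then have "(\<Prod>i\<in>UNIV. indicator {-M..M} ((x :: (real, 'n) vec) $ i)) = (0::ennreal)"
        by (intro prod_zero) (auto simp del: atLeastAtMost_iff intro!: exI[of _ i])
      then show ?thesis by (metis mult_zero_right zero_le)
    qed
  qed
  also have "\<dots> = ennreal K * (\<integral>\<^sup>+x. (\<Prod>i\<in>UNIV. ennreal (\<bar>x $ i\<bar> powr g i) * indicator {-M..M} ((x :: (real, 'n) vec) $ i)) \<partial>lborel)"
    by (rule nn_integral_cmult) measurable
  also have "(\<integral>\<^sup>+x. (\<Prod>i\<in>UNIV. ennreal (\<bar>x $ i\<bar> powr g i) * indicator {-M..M} ((x :: (real, 'n) vec) $ i)) \<partial>lborel) =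
     (\<integral>\<^sup>+x. (\<Prod>j\<in>Basis. ennreal (\<bar>x \<bullet> j\<bar> powr h j) * indicator {-M..M} (x \<bullet> j)) \<partial>lborel)"
    unfolding Basis_vec_eq by (subst prod.reindex[OF inj]) (simp add: h inner_axis o_def)
  also have "\<dots> = (\<Prod>j\<in>(Basis :: ((real, 'n) vec) set). \<integral>\<^sup>+t. ennreal (\<bar>t\<bar> powr h j) * indicator {-M..M} t \<partial>lborel)"
    by (rule nn_integral_lborel_prod) auto
  also have "ennreal K * \<dots> < \<infinity>"
  proof -
    have "(\<integral>\<^sup>+t. ennreal (\<bar>t\<bar> powr h j) * indicator {-M..M} t \<partial>lborel) \<noteq> top" for j
      using nn_integral_abs_powr_finite[OF _ M, of "h j"] g by (simp add: h_def less_top)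
    then have "(\<Prod>j\<in>(Basis :: (real, 'n) vec set). \<integral>\<^sup>+t. ennreal (\<bar>t\<bar> powr h j) * indicator {-M..M} t \<partial>lborel) \<noteq> top"
      by (auto simp: ennreal_prod_eq_top)
    then show ?thesis by (auto simp: ennreal_mult_less_top less_top)
  qed
  finally show ?thesis .
qed

text \<open>\<open>u\<close> is bounded and supported in a cube, so local integrability of the
  weight suffices.\<close>

lemma weighted_norm_finite:
  assumes n: "2 \<le> CARD('n::{finite,linorder})"
    and a: "1 - real CARD(('n::{finite,linorder})) < a" and b: "- real CARD(('n::{finite,linorder})) < a + b" and p: "0 \<le> p"
    and u: "(u :: real ^ ('n::{finite,linorder}) \<Rightarrow> real) \<in> C01"
  shows "(\<integral>\<^sup>+x. ennreal (weight b a x * \<bar>u x\<bar> powr p) \<partial>lborel) < \<infinity>"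
proof -
  let ?S = "closure {x. u x \<noteq> 0}"
  have S: "compact ?S" using u by (simp add: C01_def)
  obtain M where M: "\<And>x. x \<in> ?S \<Longrightarrow> norm x \<le> M" "0 \<le> M"
    using compact_imp_bounded[OF S] unfolding bounded_pos by (meson less_imp_le)
  have "compact (u ` ?S)"
    using S C01_continuous(1)[OF u] by (intro compact_continuous_image) (auto intro: continuous_on_subset)
  then have "bounded (u ` ?S)" by (rule compact_imp_bounded)
  then obtain B where B: "\<And>x. x \<in> ?S \<Longrightarrow> \<bar>u x\<bar> \<le> B" "0 \<le> B"
    unfolding bounded_pos real_norm_def ball_simps by (meson less_imp_le)
  have "(\<integral>\<^sup>+x. ennreal (weight b a x * \<bar>u x\<bar> powr p) \<partial>lborel) \<le>
    (\<integral>\<^sup>+x. ennreal (B powr p) * (ennreal (weight b a x) * (\<Prod>i\<in>UNIV. indicator {-M..M} ((x :: (real, 'n) vec) $ i))) \<partial>lborel)"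
  proof (rule nn_integral_mono)
    fix x
    show "ennreal (weight b a x * \<bar>u x\<bar> powr p) \<le>
      ennreal (B powr p) * (ennreal (weight b a x) * (\<Prod>i\<in>UNIV. indicator {-M..M} ((x :: (real, 'n) vec) $ i)))"
    proof (cases "u x = 0")
      case False
      then have x: "x \<in> ?S" using closure_subset[of "{x. u x \<noteq> 0}"] by auto
      have "x $ i \<in> {-M..M}" for i using component_le_norm_cart[of x i] M(1)[OF x] by auto
      moreover have "weight b a x * \<bar>u x\<bar> powr p \<le> B powr p * weight b a x"
        using B(1)[OF x] p by (subst mult.commute) (intro mult_right_mono powr_mono2, auto)
      ultimately show ?thesis by (simp add: ennreal_mult[symmetric] ennreal_leI del: atLeastAtMost_iff)
    qed simp
  qed
  also have "\<dots> = ennreal (B powr p) * (\<integral>\<^sup>+x. (ennreal (weight b a x) * (\<Prod>i\<in>UNIV. indicator {-M..M} ((x :: (real, 'n) vec) $ i))) \<partial>lborel)"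
    by (rule nn_integral_cmult) measurable
  also have "\<dots> < \<infinity>"
    using weight_integrable_cube[OF n a b M(2)] by (auto simp: ennreal_mult_less_top)
  finally show ?thesis .
qed

section \<open>The inequality for equal exponents\<close>

lemma restr_UNIV [simp]: "restr UNIV x = x"
  by (simp add: restr_def)

lemma dil_UNIV: "dil UNIV t x = t *\<^sub>R x"
  by (simp add: dil_def vec_eq_iff)

lemma weight_scaleR:
  assumes "0 < t"
  shows "weight b a (t *\<^sub>R x) = t powr (a + b) * weight b a x"
  using assms linear_scale[OF bounded_linear.linear[OF bounded_linear_restr], of "- {Max UNIV}" t x]
  by (simp add: weight_def drop_last_restr powr_mult powr_add ac_simps)

text \<open>The two weights differ by the factor (|x'|/|x|)^p, which is at most 1.\<close>

lemma weight_shift_le: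
  assumes "0 \<le> p"
  shows "weight (b - p) (a + p) x \<le> weight b a x"
proof (cases "drop_last x = 0")
  case True
  then show ?thesis by (simp add: weight_def)
next
  case False
  define R r where "R = norm x" and "r = norm (drop_last x)"
  have r: "0 < r" "r \<le> R" using False norm_drop_last_le[of x] by (auto simp: r_def R_def)
  have "weight (b - p) (a + p) x = R powr (b - p) * (r powr a * r powr p)"
    by (simp add: weight_def R_def r_def powr_add)
  also have "\<dots> \<le> R powr (b - p) * (r powr a * R powr p)"
    using r assms by (intro mult_left_mono powr_mono2) auto
  also have "\<dots> = R powr (b - p + p) * r powr a"
    unfolding powr_add by (simp add: ac_simps)
  finally show ?thesis by (simp add: weight_def R_def r_def)
qed

text \<open>The lower bound is the triangle inequality. Its loss is proportional to
  \<open>norm (restr S x)\<close>, hence small compared with |x| near the axis when only x' is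
  dilated.\<close>

lemma norm_dil_bounds:
  assumes "1 \<le> t"
  shows "norm (dil S (1 / t) x) \<le> norm x"
    and "norm x - (1 - 1 / t) * norm (restr S x) \<le> norm (dil S (1 / t) x)"
proof -
  show "norm (dil S (1 / t) x) \<le> norm x"
    using assms by (intro norm_le_componentwise_cart)
      (auto simp: dil_def abs_mult divide_le_eq mult_le_cancel_left1)
  have "norm x \<le> norm (dil S (1 / t) x) + norm ((1 - 1 / t) *\<^sub>R restr S x)"
    by (rule order_trans[OF _ norm_triangle_ineq]) (simp add: dil_eq algebra_simps)
  then show "norm x - (1 - 1 / t) * norm (restr S x) \<le> norm (dil S (1 / t) x)"
    using assms by simp
qed

lemma norm_dil_ge_half:
  assumes "1 \<le> t" "t \<le> 2"
  shows "norm x / 2 \<le> norm (dil S (1 / t) x)"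
proof -
  have "(1 - 1 / t) * norm (restr S x) \<le> (1 / 2) * norm x"
    using assms norm_restr_le[of S x] by (intro mult_mono) (auto simp: field_simps)
  then show ?thesis using norm_dil_bounds(2)[OF assms(1), of x S] by simp
qed

lemma powr_comparable:
  fixes r s e :: real
  assumes "0 < r" "r / 2 \<le> s" "s \<le> r"
  shows "s powr e \<le> 2 powr \<bar>e\<bar> * r powr e"
proof (cases "0 \<le> e")
  case True
  then have "s powr e \<le> 1 * r powr e" using assms by (simp add: powr_mono2)
  also have "\<dots> \<le> 2 powr \<bar>e\<bar> * r powr e" by (intro mult_right_mono) (auto simp: ge_one_powr_ge_zero)
  finally show ?thesis .
next
  case False
  then have "s powr e \<le> (r / 2) powr e" using assms by (intro powr_mono2') auto
  also have "\<dots> = 2 powr \<bar>e\<bar> * r powr e"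
    using False assms by (simp add: powr_divide powr_minus_divide field_simps powr_minus)
  finally show ?thesis .
qed

text \<open>Finiteness of \<open>X\<close> allows \<open>\<theta> * X\<close> to be subtracted. If
  \<open>Z\<close> is infinite, so is the right-hand side, because \<open>c\<close> is
  positive.\<close>

lemma ennreal_absorb:
  fixes X Z :: ennreal
  assumes le: "X \<le> ennreal \<theta> * X + ennreal c * Z" and X: "X < \<infinity>" and th: "0 \<le> \<theta>" "\<theta> < 1" and c: "0 < c"
  shows "X \<le> ennreal (c / (1 - \<theta>)) * Z"
proof (cases Z)
  case top
  have "0 < c / (1 - \<theta>)" using c th by simp
  then show ?thesis using top c th by (auto simp: ennreal_mult_top)
next
  case (real z)
  then obtain x where x: "X = ennreal x" "0 \<le> x" using X by (cases X) auto
  have "ennreal x \<le> ennreal (\<theta> * x + c * z)"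
    using le real x th c by (simp add: ennreal_mult ennreal_plus)
  then have "x \<le> \<theta> * x + c * z" using x th c real by (subst (asm) ennreal_le_iff) auto
  then have "x * (1 - \<theta>) \<le> c * z" by (simp add: algebra_simps)
  then show ?thesis using x real th c by (simp add: ennreal_mult[symmetric] field_simps)
qed

text \<open>With \<open>s\<close> strictly between \<open>q\<close> and 1 and
  \<open>1 - l = s powr (1 / p)\<close>, the factor \<open>(1 - l) powr (1 - p)\<close> is at most
  \<open>1 / s\<close>. So a contraction factor \<open>q\<close> survives the loss in
  \<open>powr_add_le_weighted\<close>.\<close>

lemma ex_weight_factor:
  fixes q p :: real
  assumes q: "0 \<le> q" "q < 1" and p: "1 \<le> p"
  obtains l where "0 < l" "l < 1" "(1 - l) powr (1 - p) * q < 1"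
proof -
  define s where "s = (1 + q) / 2"
  have s: "0 < s" "s < 1" "q < s" using q by (auto simp: s_def)
  define l where "l = 1 - s powr (1 / p)"
  have sp: "0 < s powr (1 / p)" "s powr (1 / p) < 1"
    using s p powr_less_mono2[of "1 / p" s 1] by auto
  have "(1 - p) / p = - ((p - 1) / p)" by (simp add: minus_divide_left)
  then have "(1 - l) powr (1 - p) = s powr (- ((p - 1) / p))"
    by (simp add: l_def powr_powr)
  also have "\<dots> \<le> s powr (- 1)"
    using s p by (intro powr_mono') (auto simp: field_simps)
  finally have "(1 - l) powr (1 - p) * q \<le> s powr (- 1) * q" using q by (intro mult_right_mono)
  also have "\<dots> < 1" using s by (simp add: powr_minus field_simps)
  finally show ?thesis using that[of l] sp by (simp add: l_def)
qed

section \<open>The estimates from the full dilation and from the dilation of x'\<close>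

lemma divide_power_mult_half_powr:
  fixes x e :: real
  shows "x / 2 ^ k * (1 / 2) powr e = x * 2 powr (- (e + real k))"
  by (simp add: powr_divide powr_minus powr_diff powr_realpow field_simps)

text \<open>The full dilation is used with the weight \<open>weight (b - p) (a + p)\<close>,
  homogeneous of degree \<open>a + b\<close>. Here \<open>restr UNIV x\<close> is x itself, so the
  gradient term carries an extra |x|^p, which restores the exponent \<open>b\<close>.\<close>

lemma radial_estimate:
  assumes n: "2 \<le> CARD('n::{finite,linorder})" and p: "1 \<le> p"
    and a: "1 - real CARD('n::{finite,linorder}) < a" and b: "- real CARD('n::{finite,linorder}) < a + b"
  obtains C where "0 < C"
    and "\<And>u :: real ^ ('n::{finite,linorder}) \<Rightarrow> real. u \<in> C01 \<Longrightarrow>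
      (\<integral>\<^sup>+x. ennreal (weight (b - p) (a + p) x * \<bar>u x\<bar> powr p) \<partial>lborel) \<le>
      ennreal C * (\<integral>\<^sup>+x. ennreal (weight b (a + p) x * norm (grad u x) powr p) \<partial>lborel)"
proof -
  let ?W = "weight (b - p) (a + p) :: (real, 'n) vec \<Rightarrow> real"
  \<comment> \<open>The scaling factor \<open>(1 / 2) powr (a + b)\<close> of the weight times the
    Jacobian \<open>1 / 2 ^ n\<close>; it is below 1 by the hypothesis on
    \<open>a + b\<close>.\<close>
  define q where "q = 2 powr (- (a + b + CARD('n)))"
  have q: "0 \<le> q" "q < 1" using b by (auto simp: q_def powr_less_one)
  then obtain l where l: "0 < l" "l < 1" "(1 - l) powr (1 - p) * q < 1"
    using ex_weight_factor[OF q p] by metis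
  define \<theta> where "\<theta> = (1 - l) powr (1 - p) * q"
  define K where "K = 2 powr \<bar>a + b + p\<bar>"
  define c where "c = l powr (1 - p) * K"
  have th: "0 \<le> \<theta>" "\<theta> < 1" using q l by (auto simp: \<theta>_def)
  have c: "0 < c" using l by (auto simp: c_def K_def)
  show ?thesis
  proof (rule that)
    show "0 < c / (1 - \<theta>)" using c th by simp
  next
    fix u :: "(real, 'n) vec \<Rightarrow> real"
    assume u: "u \<in> C01"
    note [measurable] = C01_measurable[OF u]
    define Y where "Y = (\<integral>\<^sup>+x. ennreal (?W x * \<bar>u x\<bar> powr p) \<partial>lborel)"
    define Z where "Z = (\<integral>\<^sup>+x. ennreal (weight b (a + p) x * norm (grad u x) powr p) \<partial>lborel)"
    have V: "?W (dil UNIV (1 / t) x) * norm (restr UNIV (dil UNIV (1 / t) x)) powr p \<le> K * weight b (a + p) x"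
      if t: "1 \<le> t" "t \<le> 2" for t x
    proof -
      have "?W (dil UNIV (1 / t) x) * norm (restr UNIV (dil UNIV (1 / t) x)) powr p = weight b (a + p) (dil UNIV (1 / t) x)"
        by (simp add: weight_def ac_simps powr_add[symmetric])
      also have "\<dots> = (1 / t) powr (a + b + p) * weight b (a + p) x"
        using t by (simp add: dil_UNIV weight_scaleR ac_simps)
      also have "(1 / t) powr (a + b + p) \<le> K"
        using powr_comparable[of 1 "1 / t" "a + b + p"] t by (simp add: K_def)
      finally show ?thesis by (simp add: mult_right_mono)
    qed
    have "Y \<le> ennreal ((1 - l) powr (1 - p) / 2 ^ CARD('n)) * (\<integral>\<^sup>+x. ennreal (?W (dil UNIV (1 / 2) x) * \<bar>u x\<bar> powr p) \<partial>lborel) +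
      ennreal (l powr (1 - p)) * (\<integral>\<^sup>+x. ennreal (K * weight b (a + p) x * norm (grad u x) powr p) \<partial>lborel)"
      unfolding Y_def by (rule weighted_dil_inequality[OF u p l(1,2) _ _ _ V]) auto
    also have "(\<integral>\<^sup>+x. ennreal (?W (dil UNIV (1 / 2) x) * \<bar>u x\<bar> powr p) \<partial>lborel) = ennreal ((1 / 2) powr (a + b)) * Y"
      unfolding Y_def by (subst nn_integral_cmult[symmetric])
        (auto simp: dil_UNIV weight_scaleR[where t="1/2", simplified] ennreal_mult[symmetric] mult.assoc add.commute intro!: nn_integral_cong)
    also have "(\<integral>\<^sup>+x. ennreal (K * weight b (a + p) x * norm (grad u x) powr p) \<partial>lborel) = ennreal K * Z"
      unfolding Z_def by (subst nn_integral_cmult[symmetric])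
        (auto simp: K_def ennreal_mult[symmetric] mult.assoc intro!: nn_integral_cong)
    also have "ennreal ((1 - l) powr (1 - p) / 2 ^ CARD('n)) * (ennreal ((1 / 2) powr (a + b)) * Y) = ennreal \<theta> * Y"
    proof -
      have "\<theta> = (1 - l) powr (1 - p) / 2 ^ CARD('n) * (1 / 2) powr (a + b)"
        unfolding divide_power_mult_half_powr by (simp add: \<theta>_def q_def)
      then show ?thesis by (simp add: mult.assoc[symmetric] ennreal_mult[symmetric])
    qed
    also have "ennreal (l powr (1 - p)) * (ennreal K * Z) = ennreal c * Z"
      by (simp add: mult.assoc[symmetric] ennreal_mult[symmetric] c_def K_def)
    finally have le: "Y \<le> ennreal \<theta> * Y + ennreal c * Z" .
    \<comment> \<open>Absorption needs \<open>Y\<close> finite; the shifted weight lies below the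
      locally integrable \<open>weight b a\<close>.\<close>
    have "Y \<le> (\<integral>\<^sup>+x. ennreal (weight b a x * \<bar>u x\<bar> powr p) \<partial>lborel)"
      unfolding Y_def using p by (intro nn_integral_mono ennreal_leI mult_right_mono weight_shift_le) auto
    also have "\<dots> < \<infinity>"
      using p by (intro weighted_norm_finite[OF n a b _ u]) auto
    finally have fin: "Y < \<infinity>" .
    show "Y \<le> ennreal (c / (1 - \<theta>)) * Z" by (rule ennreal_absorb[OF le fin th c])
  qed
qed

text \<open>Here \<open>R\<close>, \<open>r\<close> and \<open>s\<close> stand for |x|, |x'| and the
  norm of x after x' is halved. Only negative \<open>b\<close> is at issue. Near the axis
  \<open>s\<close> is so close to \<open>R\<close> that the factor \<open>1 + \<eta>\<close>
  suffices. Otherwise \<open>r\<close> is at least a fixed multiple of \<open>R\<close>, and the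
  last term dominates.\<close>

lemma powr_dil_half_le:
  fixes b p \<eta> :: real
  assumes eta: "0 < \<eta>" and p: "0 \<le> p"
  obtains D where "0 < D"
    and "\<And>R r s. 0 < r \<Longrightarrow> r \<le> R \<Longrightarrow> s \<le> R \<Longrightarrow> R - r / 2 \<le> s \<Longrightarrow>
      s powr b \<le> (1 + \<eta>) * R powr b + D * (R powr (b - p) * r powr p)"
proof (cases "0 \<le> b")
  case True
  show ?thesis
  proof (rule that[of 1])
    fix R r s :: real assume "0 < r" "r \<le> R" "s \<le> R" "R - r / 2 \<le> s"
    then have "s powr b \<le> 1 * R powr b" using True by (simp add: powr_mono2)
    also have "\<dots> \<le> (1 + \<eta>) * R powr b" using eta by (intro mult_right_mono) auto
    finally show "s powr b \<le> (1 + \<eta>) * R powr b + 1 * (R powr (b - p) * r powr p)" by (simp add: add_increasing2)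
  qed simp
next
  case False
  \<comment> \<open>The threshold for \<open>s / R\<close>: at \<open>s = k * R\<close> the power
    \<open>s powr b\<close> is exactly \<open>(1 + \<eta>) * R powr b\<close>.\<close>
  define k where "k = (1 + \<eta>) powr (1 / b)"
  have k: "0 < k" "k < 1" "k powr b = 1 + \<eta>"
    using False eta by (auto simp: k_def powr_powr powr_less_one divide_pos_neg)
  define D where "D = 2 powr (- b) * (2 * (1 - k)) powr (- p)"
  show ?thesis
  proof (rule that[of D])
    show "0 < D" using k by (simp add: D_def)
    fix R r s :: real assume r: "0 < r" "r \<le> R" "s \<le> R" "R - r / 2 \<le> s"
    show "s powr b \<le> (1 + \<eta>) * R powr b + D * (R powr (b - p) * r powr p)"
    proof (cases "k * R \<le> s")
      case True
      then have "s powr b \<le> (k * R) powr b" using r k \<open>\<not> 0 \<le> b\<close> by (intro powr_mono2') auto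
      also have "\<dots> = (1 + \<eta>) * R powr b" using r k by (simp add: powr_mult)
      finally show ?thesis using k by (simp add: add_increasing2 D_def)
    next
      case F: False
      then have kr: "2 * (1 - k) * R \<le> r" using r by (simp add: algebra_simps)
      \<comment> \<open>From \<open>r \<le> R\<close> it follows that \<open>s\<close> is at least
        \<open>R / 2\<close>.\<close>
      have "s powr b \<le> (R / 2) powr b" using r \<open>\<not> 0 \<le> b\<close> by (intro powr_mono2') auto
      also have "\<dots> = 2 powr (- b) * (2 * (1 - k)) powr (- p) * (R powr (b - p) * (2 * (1 - k) * R) powr p)"
      proof -
        define E where "E = 2 * (1 - k)"
        have "0 < E" using k by (simp add: E_def)
        then show ?thesis
          unfolding E_def[symmetric] using r
          by (simp add: powr_divide powr_mult powr_diff powr_minus field_simps)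
      qed
      also have "\<dots> \<le> D * (R powr (b - p) * r powr p)"
        unfolding D_def using kr r k p by (intro mult_left_mono powr_mono2) auto
      finally show ?thesis using eta by (simp add: add_increasing)
    qed
  qed
qed

text \<open>Only x' is dilated, with the weight itself. Then \<open>norm (restr S x)\<close> is
  |x'|, so the gradient weight has the exponent \<open>a + p\<close>. The change of |x|^b under this
  dilation is split by \<open>powr_dil_half_le\<close> into a factor \<open>1 + \<eta>\<close> and a
  term covered by \<open>radial_estimate\<close>.\<close>

lemma weighted_hardy:
  assumes n: "2 \<le> CARD('n::{finite,linorder})" and p: "1 \<le> p"
    and a: "1 - real CARD('n::{finite,linorder}) < a" and b: "- real CARD('n::{finite,linorder}) < a + b"
  obtains C where "0 < C"
    and "\<And>u :: real ^ ('n::{finite,linorder}) \<Rightarrow> real. u \<in> C01 \<Longrightarrow>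
      (\<integral>\<^sup>+x. ennreal (weight b a x * \<bar>u x\<bar> powr p) \<partial>lborel) \<le>
      ennreal C * (\<integral>\<^sup>+x. ennreal (weight b (a + p) x * norm (grad u x) powr p) \<partial>lborel)"
proof -
  let ?S = "- {Max UNIV} :: 'n set"
  define m where "m = card ?S"
  have m: "real m = real CARD('n) - 1"
    using n by (simp add: m_def Compl_eq_Diff_UNIV card_Diff_singleton)
  obtain C1 where C1: "0 < C1" and rad: "\<And>u :: (real, 'n) vec \<Rightarrow> real. u \<in> C01 \<Longrightarrow>
      (\<integral>\<^sup>+x. ennreal (weight (b - p) (a + p) x * \<bar>u x\<bar> powr p) \<partial>lborel) \<le>
      ennreal C1 * (\<integral>\<^sup>+x. ennreal (weight b (a + p) x * norm (grad u x) powr p) \<partial>lborel)"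
    by (rule radial_estimate[OF n p a b], rule that)
  \<comment> \<open>The factor \<open>(1 / 2) powr a\<close> from |x'|^a times the Jacobian
    \<open>1 / 2 ^ m\<close>; it is below 1 by the hypothesis on \<open>a\<close>.\<close>
  define q where "q = 2 powr (- (a + m))"
  have q: "0 < q" "q < 1" using a m by (auto simp: q_def powr_less_one)
  then obtain l where l: "0 < l" "l < 1" "(1 - l) powr (1 - p) * q < 1"
    using ex_weight_factor[of q p] p by (metis less_imp_le)
  define A where "A = (1 - l) powr (1 - p) * q"
  have A: "0 < A" "A < 1" using l q by (auto simp: A_def)
  \<comment> \<open>With this choice \<open>\<theta> = (1 + A) / 2\<close>, which is still below
    1.\<close>
  define \<eta> where "\<eta> = (1 / A - 1) / 2"
  define \<theta> where "\<theta> = A * (1 + \<eta>)"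
  have eta: "0 < \<eta>" using A by (simp add: \<eta>_def field_simps)
  have th: "0 \<le> \<theta>" "\<theta> < 1" using A by (auto simp: \<theta>_def \<eta>_def field_simps)
  obtain D where D: "0 < D"
    and half: "\<And>R r s. 0 < r \<Longrightarrow> r \<le> R \<Longrightarrow> s \<le> R \<Longrightarrow> R - r / 2 \<le> s \<Longrightarrow>
      s powr b \<le> (1 + \<eta>) * R powr b + D * (R powr (b - p) * r powr p)"
    by (rule powr_dil_half_le[OF eta order_trans[OF zero_le_one p], of b], rule that)
  define K where "K = 2 powr \<bar>b\<bar> * 2 powr \<bar>a + p\<bar>"
  \<comment> \<open>The first summand is the gradient term coming from the radial estimate, the
    second the one from the dilation of x'.\<close>
  define c where "c = A * D * C1 + l powr (1 - p) * K"
  have c: "0 < c" using A D C1 l by (auto simp: c_def K_def intro!: add_pos_pos)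
  show ?thesis
  proof (rule that)
    show "0 < c / (1 - \<theta>)" using c th by simp
  next
    fix u :: "(real, 'n) vec \<Rightarrow> real"
    assume u: "u \<in> C01"
    note [measurable] = C01_measurable[OF u]
    define X where "X = (\<integral>\<^sup>+x. ennreal (weight b a x * \<bar>u x\<bar> powr p) \<partial>lborel)"
    define Y where "Y = (\<integral>\<^sup>+x. ennreal (weight (b - p) (a + p) x * \<bar>u x\<bar> powr p) \<partial>lborel)"
    define Z where "Z = (\<integral>\<^sup>+x. ennreal (weight b (a + p) x * norm (grad u x) powr p) \<partial>lborel)"
    have dl: "drop_last (dil ?S t x) = t *\<^sub>R drop_last x" for t x
      by (simp add: drop_last_restr restr_dil)
    have V: "weight b a (dil ?S (1 / t) x) * norm (restr ?S (dil ?S (1 / t) x)) powr p \<le> K * weight b (a + p) x"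
      if t: "1 \<le> t" "t \<le> 2" for t and x :: "(real, 'n) vec"
    proof (cases "drop_last x = 0")
      case True
      then show ?thesis by (simp add: weight_def dl)
    next
      case False
      then have x: "0 < norm x" "0 < norm (drop_last x)" using norm_drop_last_le[of x] by auto
      have "weight b a (dil ?S (1 / t) x) * norm (restr ?S (dil ?S (1 / t) x)) powr p =
          norm (dil ?S (1 / t) x) powr b * (norm (drop_last x) / t) powr (a + p)"
        using t unfolding powr_add by (simp add: weight_def dl drop_last_restr[symmetric] restr_dil)
      \<comment> \<open>For t between 1 and 2 neither norm grows, and neither falls below half of
        its value.\<close>
      also have "\<dots> \<le> (2 powr \<bar>b\<bar> * norm x powr b) * (2 powr \<bar>a + p\<bar> * norm (drop_last x) powr (a + p))"
        using t x norm_dil_bounds(1)[OF t(1), of ?S x] norm_dil_ge_half[OF t, of x ?S]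
        by (intro mult_mono powr_comparable) (auto simp: field_simps)
      finally show ?thesis by (simp add: K_def weight_def ac_simps)
    qed
    have W: "weight b a (dil ?S (1 / 2) x) \<le>
        (1 / 2) powr a * ((1 + \<eta>) * weight b a x + D * weight (b - p) (a + p) x)" for x :: "(real, 'n) vec"
    proof (cases "drop_last x = 0")
      case True
      then show ?thesis by (simp add: weight_def dl)
    next
      case False
      \<comment> \<open>The lower bound in \<open>norm_dil_bounds\<close> at \<open>t = 2\<close>
        has exactly the form \<open>R - r / 2 \<le> s\<close>.\<close>
      have "norm (dil ?S (1 / 2) x) powr b \<le> (1 + \<eta>) * norm x powr b +
          D * (norm x powr (b - p) * norm (drop_last x) powr p)"
        using False norm_drop_last_le[of x] norm_dil_bounds(1)[of 2 ?S x] norm_dil_bounds(2)[of 2 x ?S]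
        by (intro half) (auto simp: drop_last_restr)
      then have "norm (dil ?S (1 / 2) x) powr b * ((1 / 2) powr a * norm (drop_last x) powr a) \<le>
        ((1 + \<eta>) * norm x powr b + D * (norm x powr (b - p) * norm (drop_last x) powr p)) *
          ((1 / 2) powr a * norm (drop_last x) powr a)"
        by (intro mult_right_mono) auto
      then show ?thesis
        by (simp add: weight_def dl powr_mult powr_divide powr_add algebra_simps)
    qed
    have "X \<le> ennreal ((1 - l) powr (1 - p) / 2 ^ m) * (\<integral>\<^sup>+x. ennreal (weight b a (dil ?S (1 / 2) x) * \<bar>u x\<bar> powr p) \<partial>lborel) +
      ennreal (l powr (1 - p)) * (\<integral>\<^sup>+x. ennreal (K * weight b (a + p) x * norm (grad u x) powr p) \<partial>lborel)"
      unfolding X_def m_def by (rule weighted_dil_inequality[OF u p l(1,2) _ _ _ V]) auto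
    also have "(\<integral>\<^sup>+x. ennreal (K * weight b (a + p) x * norm (grad u x) powr p) \<partial>lborel) = ennreal K * Z"
      unfolding Z_def by (subst nn_integral_cmult[symmetric])
        (auto simp: K_def ennreal_mult[symmetric] mult.assoc intro!: nn_integral_cong)
    also have "(\<integral>\<^sup>+x. ennreal (weight b a (dil ?S (1 / 2) x) * \<bar>u x\<bar> powr p) \<partial>lborel) \<le>
      (\<integral>\<^sup>+x. ennreal ((1 / 2) powr a * (1 + \<eta>)) * ennreal (weight b a x * \<bar>u x\<bar> powr p) +
        ennreal ((1 / 2) powr a * D) * ennreal (weight (b - p) (a + p) x * \<bar>u x\<bar> powr p) \<partial>lborel)"
    proof (rule nn_integral_mono)
      fix x
      have "weight b a (dil ?S (1 / 2) x) * \<bar>u x\<bar> powr p \<le>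
        ((1 / 2) powr a * ((1 + \<eta>) * weight b a x + D * weight (b - p) (a + p) x)) * \<bar>u x\<bar> powr p"
        by (intro mult_right_mono W) auto
      also have "\<dots> = ((1 / 2) powr a * (1 + \<eta>)) * (weight b a x * \<bar>u x\<bar> powr p) +
          ((1 / 2) powr a * D) * (weight (b - p) (a + p) x * \<bar>u x\<bar> powr p)"
        by (simp add: algebra_simps)
      finally show "ennreal (weight b a (dil ?S (1 / 2) x) * \<bar>u x\<bar> powr p) \<le>
          ennreal ((1 / 2) powr a * (1 + \<eta>)) * ennreal (weight b a x * \<bar>u x\<bar> powr p) +
          ennreal ((1 / 2) powr a * D) * ennreal (weight (b - p) (a + p) x * \<bar>u x\<bar> powr p)"
        using eta D by (subst (1 2) ennreal_mult[symmetric], simp_all add: ennreal_plus[symmetric] ennreal_leI del: ennreal_plus)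
    qed
    also have "\<dots> = ennreal ((1 / 2) powr a * (1 + \<eta>)) * X + ennreal ((1 / 2) powr a * D) * Y"
      unfolding X_def Y_def by (subst nn_integral_add) (auto simp: nn_integral_cmult)
    also have "\<dots> \<le> ennreal ((1 / 2) powr a * (1 + \<eta>)) * X + ennreal ((1 / 2) powr a * D) * (ennreal C1 * Z)"
      unfolding Y_def Z_def by (intro add_left_mono mult_left_mono rad[OF u]) auto
    also have "ennreal ((1 - l) powr (1 - p) / 2 ^ m) *
        (ennreal ((1 / 2) powr a * (1 + \<eta>)) * X + ennreal ((1 / 2) powr a * D) * (ennreal C1 * Z)) +
        ennreal (l powr (1 - p)) * (ennreal K * Z) = ennreal \<theta> * X + ennreal c * Z"
    proof -
      have Aeq: "(1 - l) powr (1 - p) / 2 ^ m * (1 / 2) powr a = A"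
        unfolding divide_power_mult_half_powr by (simp add: A_def q_def)
      have e1: "ennreal ((1 - l) powr (1 - p) / 2 ^ m) * (ennreal ((1 / 2) powr a * (1 + \<eta>)) * X) = ennreal \<theta> * X"
        unfolding \<theta>_def Aeq[symmetric] using eta
        by (simp add: mult.assoc[symmetric] ennreal_mult[symmetric])
      have e2: "ennreal ((1 - l) powr (1 - p) / 2 ^ m) * (ennreal ((1 / 2) powr a * D) * (ennreal C1 * Z)) = ennreal (A * D * C1) * Z"
        unfolding Aeq[symmetric] using D C1
        by (simp add: mult.assoc[symmetric] ennreal_mult[symmetric])
      have e3: "ennreal (l powr (1 - p)) * (ennreal K * Z) = ennreal (l powr (1 - p) * K) * Z"
        by (simp add: mult.assoc[symmetric] ennreal_mult[symmetric] K_def)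
      have e4: "ennreal c = ennreal (A * D * C1) + ennreal (l powr (1 - p) * K)"
        unfolding c_def using A D C1 by (intro ennreal_plus) (auto simp: K_def)
      show ?thesis
        unfolding distrib_left[of "ennreal ((1 - l) powr (1 - p) / 2 ^ m)"] e1 e2 e3 e4
        by (simp add: distrib_right add.assoc)
    qed
    finally have le: "X \<le> ennreal \<theta> * X + ennreal c * Z"
      by (simp add: mult_left_mono add_right_mono)
    have fin: "X < \<infinity>"
      unfolding X_def using p by (intro weighted_norm_finite[OF n a b _ u]) auto
    show "X \<le> ennreal (c / (1 - \<theta>)) * Z" by (rule ennreal_absorb[OF le fin th c])
  qed
qed

section \<open>Functions concentrating near the axis\<close>

lemma weight_powr: "weight b a x powr p = weight (b * p) (a * p) x"
  by (simp add: weight_def powr_mult powr_powr)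

text \<open>Taking p-th powers is monotone. If the integral of \<open>g\<close> is infinite, both
  sides of the equivalence hold because \<open>C\<close> is positive; if only that of
  \<open>f\<close> is, both fail.\<close>

lemma Lp_norm_le_iff:
  assumes p: "0 < p" and C: "0 < C"
  shows "Lp_norm p f \<le> ennreal C * Lp_norm p g \<longleftrightarrow>
    (\<integral>\<^sup>+x. ennreal (norm (f x) powr p) \<partial>lborel) \<le> ennreal (C powr p) * (\<integral>\<^sup>+x. ennreal (norm (g x) powr p) \<partial>lborel)"
    (is "_ \<longleftrightarrow> ?F \<le> _ * ?G")
proof (cases ?G)
  case top
  then show ?thesis using C by (simp add: Lp_norm_def ennreal_mult_top)
next
  case G: (real y)
  show ?thesis
  proof (cases ?F)
    case top
    then show ?thesis using G C by (simp add: Lp_norm_def ennreal_mult[symmetric] top_unique)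
  next
    case F: (real x)
    have "x powr (1 / p) \<le> C * y powr (1 / p) \<longleftrightarrow> x \<le> C powr p * y"
    proof
      assume "x powr (1 / p) \<le> C * y powr (1 / p)"
      then have "(x powr (1 / p)) powr p \<le> (C * y powr (1 / p)) powr p"
        using p by (intro powr_mono2) auto
      then show "x \<le> C powr p * y" using p F G by (simp add: powr_mult powr_powr)
    next
      assume "x \<le> C powr p * y"
      then have "x powr (1 / p) \<le> (C powr p * y) powr (1 / p)"
        using p F by (intro powr_mono2) auto
      then show "x powr (1 / p) \<le> C * y powr (1 / p)" using p C by (simp add: powr_mult powr_powr)
    qed
    then show ?thesis
      using F G C by (simp add: Lp_norm_def ennreal_mult[symmetric])
  qed
qed

lemma grad_eqI:
  assumes "(u has_derivative (\<lambda>h. h \<bullet> v)) (at x)"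
  shows "grad u x = v"
  by (simp add: grad_def vec_eq_iff inner_axis' frechet_derivative_at[OF assms, symmetric])

lemma inner_dil: "dil S t x \<bullet> y = x \<bullet> dil S t y"
  by (auto simp: inner_vec_def dil_def intro!: sum.cong)

lemma bounded_linear_dil: "bounded_linear (dil S t)"
  unfolding linear_conv_bounded_linear[symmetric]
  by (auto simp: dil_def linear_iff vec_eq_iff algebra_simps)

text \<open>The chain rule produces the adjoint of \<open>dil S t\<close>, which is
  \<open>dil S t\<close> again by \<open>inner_dil\<close>.\<close>

lemma grad_dil:
  assumes u: "u \<in> C01"
  shows "((\<lambda>x. u (dil S t x)) has_derivative (\<lambda>h. h \<bullet> dil S t (grad u (dil S t x)))) (at x)"
    and "grad (\<lambda>x. u (dil S t x)) x = dil S t (grad u (dil S t x))"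
proof -
  have 1: "(u has_derivative (\<lambda>h. h \<bullet> grad u (dil S t x))) (at (dil S t x))"
    using gderiv_grad[of u "dil S t x"] u by (simp add: C01_def gderiv_def)
  have 2: "(dil S t has_derivative dil S t) (at x)"
    by (rule bounded_linear_imp_has_derivative[OF bounded_linear_dil])
  from diff_chain_at[OF 2 1]
  show "((\<lambda>x. u (dil S t x)) has_derivative (\<lambda>h. h \<bullet> dil S t (grad u (dil S t x)))) (at x)"
    by (simp add: o_def inner_dil)
  then show "grad (\<lambda>x. u (dil S t x)) x = dil S t (grad u (dil S t x))"
    by (rule grad_eqI)
qed

text \<open>For \<open>t \<ge> 1\<close> the point \<open>dil S t x\<close> is at least as long as
  \<open>x\<close>, so the support stays bounded.\<close>

lemma C01_dil:
  assumes u: "u \<in> C01" and t: "1 \<le> t"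
  shows "(\<lambda>x. u (dil S t x)) \<in> C01"
proof -
  have "bounded {x. u x \<noteq> 0}"
    using u by (intro bounded_subset[OF compact_imp_bounded closure_subset]) (simp add: C01_def)
  then obtain B where B: "\<And>x. u x \<noteq> 0 \<Longrightarrow> norm x \<le> B"
    unfolding bounded_iff by auto
  have "norm x \<le> B" if "u (dil S t x) \<noteq> 0" for x
    using norm_dil_bounds(1)[OF t, of S "dil S t x"] B[OF that] t by simp
  then have "bounded {x. u (dil S t x) \<noteq> 0}" unfolding bounded_iff by auto
  moreover have "continuous_on UNIV (\<lambda>x. dil S t (grad u (dil S t x)))"
    by (intro continuous_intros continuous_on_compose2[OF C01_continuous(2)[OF u]]) auto
  ultimately show ?thesis
    using grad_dil[OF u] unfolding C01_def
    by (auto simp: differentiable_def compact_closure cong: continuous_on_cong)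
qed

lemma norm_dil_le:
  assumes "1 \<le> t"
  shows "norm (dil S t x) \<le> t * norm x"
proof -
  have "norm (dil S t x) \<le> norm (t *\<^sub>R x)"
    using assms by (intro norm_le_componentwise_cart) (auto simp: dil_def abs_mult mult_le_cancel_right1)
  then show ?thesis using assms by simp
qed

section \<open>A continuously differentiable bump\<close>

lemma DERIV_max_0_square: "((\<lambda>s. (max 0 s)\<^sup>2) has_real_derivative 2 * max 0 s) (at s)"
proof (cases "s = 0")
  case True
  \<comment> \<open>At the kink the difference quotient is at most \<open>\<bar>h\<bar>\<close> in
    absolute value.\<close>
  have "((\<lambda>h. (max 0 h)\<^sup>2 / h) \<longlongrightarrow> 0) (at (0::real))"
    by (rule Lim_null_comparison[of _ "\<lambda>h. \<bar>h\<bar>"])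
      (auto simp: max_def power2_eq_square intro!: tendsto_eq_intros)
  then show ?thesis using True by (simp add: DERIV_def)
next
  case False
  show ?thesis
  proof (cases "0 < s")
    case True
    have "((\<lambda>s. s\<^sup>2) has_real_derivative 2 * s) (at s)" by (auto intro!: derivative_eq_intros)
    then have "((\<lambda>s. (max 0 s)\<^sup>2) has_real_derivative 2 * s) (at s)"
      by (rule has_field_derivative_transform_within_open[of _ _ _ "{0<..}"]) (use True in auto)
    then show ?thesis using True by (simp add: max_def)
  next
    case F: False
    have "((\<lambda>s. 0) has_real_derivative 0) (at s)" by simp
    then have "((\<lambda>s. (max 0 s)\<^sup>2) has_real_derivative 0) (at s)"
      by (rule has_field_derivative_transform_within_open[of _ _ _ "{..<0}"]) (use F False in auto)
    then show ?thesis using F False by (simp add: max_def)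
  qed
qed

text \<open>Squaring the positive part smooths the kink on the unit sphere about \<open>z\<close>,
  which gives the function a continuous gradient.\<close>

definition bump :: "real ^ 'n::finite \<Rightarrow> real ^ 'n \<Rightarrow> real" where
  "bump z x = (max 0 (1 - (x - z) \<bullet> (x - z)))\<^sup>2"

lemma bump_derivative:
  "(bump z has_derivative (\<lambda>h. h \<bullet> (- (4 * max 0 (1 - (x - z) \<bullet> (x - z))) *\<^sub>R (x - z)))) (at x)"
proof -
  have 1: "((\<lambda>x. 1 - (x - z) \<bullet> (x - z)) has_derivative (\<lambda>h. - (2 * (h \<bullet> (x - z))))) (at x)"
    by (auto intro!: derivative_eq_intros simp: inner_commute)
  have "((\<lambda>s. (max 0 s)\<^sup>2) has_derivative (\<lambda>h. h * (2 * max 0 (1 - (x - z) \<bullet> (x - z))))) (at (1 - (x - z) \<bullet> (x - z)))"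
    using DERIV_max_0_square[of "1 - (x - z) \<bullet> (x - z)"]
    by (simp add: has_field_derivative_def mult.commute[of _ "2 * _"] fun_eq_iff)
  from diff_chain_at[OF 1 this] show ?thesis
    unfolding bump_def[abs_def] o_def by (rule has_derivative_eq_rhs) (simp add: fun_eq_iff)
qed

lemma bump_eq_0_iff: "bump z x = 0 \<longleftrightarrow> \<not> norm (x - z) < 1"
proof -
  have "bump z x = 0 \<longleftrightarrow> \<not> (norm (x - z))\<^sup>2 < 1"
    by (auto simp: bump_def max_def dot_square_norm)
  then show ?thesis by (simp add: abs_square_less_1)
qed

lemma grad_bump: "grad (bump z) x = - (4 * max 0 (1 - (x - z) \<bullet> (x - z))) *\<^sub>R (x - z)"
  by (rule grad_eqI[OF bump_derivative])

lemma grad_bump_eq_0: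
  assumes "1 \<le> norm (x - z)"
  shows "grad (bump z) x = 0"
proof -
  have "1 \<le> (norm (x - z))\<^sup>2" using assms by (simp add: one_le_power)
  then show ?thesis by (simp add: grad_bump dot_square_norm max_def)
qed

lemma bump_C01: "bump z \<in> C01"
proof -
  have "{x. bump z x \<noteq> 0} = ball z 1"
    by (auto simp: bump_eq_0_iff dist_norm norm_minus_commute)
  moreover have "continuous_on UNIV (grad (bump z))"
    unfolding grad_bump[abs_def] by (intro continuous_intros)
  ultimately show ?thesis
    using bump_derivative unfolding C01_def by (auto simp: differentiable_def)
qed

lemma bump_norm_pos: "0 < (\<integral>\<^sup>+x. ennreal (\<bar>bump z x\<bar> powr p) \<partial>lborel)"
proof -
  have [measurable]: "bump z \<in> borel_measurable borel" by (rule C01_measurable[OF bump_C01])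
  have "\<not> (AE x in lborel. x \<notin> ball z 1)"
  proof
    assume "AE x in lborel. x \<notin> ball z 1"
    then have "emeasure lborel (ball z 1) = 0"
      using AE_iff_measurable[of "ball z 1" lborel "\<lambda>x. x \<notin> ball z 1"] by (simp del: mem_ball)
    then show False using content_ball_pos[of 1 z] by (simp add: measure_def)
  qed
  then have "(\<integral>\<^sup>+x. ennreal (\<bar>bump z x\<bar> powr p) \<partial>lborel) \<noteq> 0"
    by (subst nn_integral_0_iff_AE) (auto simp: bump_eq_0_iff dist_norm norm_minus_commute)
  then show ?thesis by (simp add: zero_less_iff_neq_zero)
qed

lemma bump_grad_norm_finite:
  assumes "0 \<le> p"
  shows "(\<integral>\<^sup>+x. ennreal (norm (grad (bump z) x) powr p) \<partial>lborel) < \<infinity>"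
proof -
  have "(\<integral>\<^sup>+x. ennreal (norm (grad (bump z) x) powr p) \<partial>lborel) \<le> (\<integral>\<^sup>+x. ennreal (4 powr p) * indicator (cball z 1) x \<partial>lborel)"
  proof (rule nn_integral_mono)
    fix x
    show "ennreal (norm (grad (bump z) x) powr p) \<le> ennreal (4 powr p) * indicator (cball z 1) x"
    proof (cases "norm (x - z) \<le> 1")
      case True
      have "norm (grad (bump z) x) \<le> 4 * 1 * 1"
        unfolding grad_bump norm_scaleR using True by (intro mult_mono) auto
      then show ?thesis
        using True assms by (auto simp: dist_norm norm_minus_commute intro!: ennreal_leI powr_mono2)
    next
      case False
      then have "grad (bump z) x = 0" by (simp add: grad_bump_eq_0)
      then show ?thesis by simp
    qed
  qed
  also have "\<dots> < \<infinity>"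
    using emeasure_lborel_cball_finite[of z 1]
    by (simp add: nn_integral_cmult_indicator ennreal_mult_less_top)
  finally show ?thesis .
qed

section \<open>Compressed bumps and the size of the weights on them\<close>

lemma powr_between:
  fixes s e :: real
  assumes "1 / 8 \<le> s" "s \<le> 8"
  shows "8 powr (- \<bar>e\<bar>) \<le> s powr e" "s powr e \<le> 8 powr \<bar>e\<bar>"
proof -
  have *: "8 powr (- \<bar>e\<bar>) = (1 / 8) powr \<bar>e\<bar>" by (simp add: powr_divide powr_minus_divide)
  have s: "0 < s" using assms by simp
  show "8 powr (- \<bar>e\<bar>) \<le> s powr e"
  proof (cases "0 \<le> e")
    case True
    then show ?thesis unfolding * using assms powr_mono2[of e "1 / 8" s] by simp
  next
    case False
    then show ?thesis using assms s powr_mono2'[of e s 8] by simp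
  qed
  show "s powr e \<le> 8 powr \<bar>e\<bar>"
  proof (cases "0 \<le> e")
    case True
    then show ?thesis using assms s powr_mono2[of e s 8] by simp
  next
    case False
    then have "s powr e \<le> (1 / 8) powr e" using assms by (intro powr_mono2') auto
    then show ?thesis using False by (simp add: powr_divide powr_minus_divide)
  qed
qed

text \<open>On the unit ball about \<open>z\<close>, both |x'| and the last coordinate stay away
  from 0. The last coordinate is not dilated, so |x| remains comparable to 1 while |x'| is divided
  by t; hence the weight behaves like \<open>t powr (- a)\<close>, uniformly in t.\<close>

lemma weight_dil_bounds:
  assumes n: "2 \<le> CARD('n::{finite,linorder})"
  obtains z :: "real ^ ('n::{finite,linorder})" where
    "\<And>t b a x. 1 \<le> t \<Longrightarrow> norm (x - z) \<le> 1 \<Longrightarrow>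
      weight b a (dil (- {Max UNIV}) (1 / t) x) \<le> 8 powr \<bar>b\<bar> * 8 powr \<bar>a\<bar> * t powr (- a)"
    "\<And>t b a x. 1 \<le> t \<Longrightarrow> norm (x - z) \<le> 1 \<Longrightarrow>
      8 powr (- \<bar>b\<bar>) * 8 powr (- \<bar>a\<bar>) * t powr (- a) \<le> weight b a (dil (- {Max UNIV}) (1 / t) x)"
proof -
  let ?S = "- {Max UNIV} :: 'n set"
  have "?S \<noteq> {}"
  proof
    assume "?S = {}"
    then have "UNIV = {Max UNIV :: 'n}" by auto
    then have "CARD('n) = 1" by (metis is_singletonI is_singleton_altdef)
    then show False using n by simp
  qed
  then obtain j where j: "j \<noteq> (Max UNIV :: 'n)" by auto
  \<comment> \<open>Entries 3 leave at least 2 in these two coordinates throughout the unit ball,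
    and norm at most 7.\<close>
  define z :: "(real, 'n) vec" where "z = 3 *\<^sub>R axis j 1 + 3 *\<^sub>R axis (Max UNIV) 1"
  have zj: "z $ j = 3" "z $ Max UNIV = 3" using j by (auto simp: z_def axis_def)
  have nz: "norm z \<le> 6" unfolding z_def by (rule order_trans[OF norm_triangle_ineq]) simp
  have main: "1 / 8 \<le> norm (dil ?S (1 / t) x)" "norm (dil ?S (1 / t) x) \<le> 8"
      "1 / 8 \<le> norm (drop_last x)" "norm (drop_last x) \<le> 8"
      "weight b a (dil ?S (1 / t) x) = norm (dil ?S (1 / t) x) powr b * norm (drop_last x) powr a * t powr (- a)"
    if t: "1 \<le> t" and x: "norm (x - z) \<le> 1" for t b a :: real and x :: "(real, 'n) vec"
  proof -
    have nx: "norm x \<le> 7" using norm_triangle_ineq[of "x - z" z] nz x by simp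
    have c: "2 \<le> x $ i" if "z $ i = 3" for i
      using component_le_norm_cart[of "x - z" i] x that by simp
    have "\<bar>dil ?S (1 / t) x $ Max UNIV\<bar> \<le> norm (dil ?S (1 / t) x)" by (rule component_le_norm_cart)
    then show "1 / 8 \<le> norm (dil ?S (1 / t) x)" using c[OF zj(2)] by (simp add: dil_def)
    have "\<bar>drop_last x $ j\<bar> \<le> norm (drop_last x)" by (rule component_le_norm_cart)
    then show "1 / 8 \<le> norm (drop_last x)" using c[OF zj(1)] j by (simp add: drop_last_def)
    show "norm (dil ?S (1 / t) x) \<le> 8" using norm_dil_bounds(1)[OF t, of ?S x] nx by simp
    show "norm (drop_last x) \<le> 8" using norm_drop_last_le[of x] nx by simp
    show "weight b a (dil ?S (1 / t) x) = norm (dil ?S (1 / t) x) powr b * norm (drop_last x) powr a * t powr (- a)"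
      using t by (simp add: weight_def drop_last_restr restr_dil powr_divide powr_minus field_simps)
  qed
  show ?thesis
  proof (rule that[of z])
    fix t b a :: real and x :: "(real, 'n) vec"
    assume t: "1 \<le> t" and x: "norm (x - z) \<le> 1"
    note m = main[OF t x]
    show "weight b a (dil ?S (1 / t) x) \<le> 8 powr \<bar>b\<bar> * 8 powr \<bar>a\<bar> * t powr (- a)"
      unfolding m(5) by (intro mult_mono mult_right_mono powr_between m) auto
    show "8 powr (- \<bar>b\<bar>) * 8 powr (- \<bar>a\<bar>) * t powr (- a) \<le> weight b a (dil ?S (1 / t) x)"
      unfolding m(5) by (intro mult_mono mult_right_mono powr_between m) auto
  qed
qed

text \<open>Substitution moves the compression onto the weights. The left-hand side is then at least
  of order \<open>t powr (- a)\<close>. The right-hand side is at most of order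
  \<open>t powr (p - a')\<close>, since compression multiplies the gradient by at most t. The two
  integrals in the conclusion do not depend on t.\<close>

lemma concentrated_bump_bounds:
  assumes n: "2 \<le> CARD('n::{finite,linorder})" and p: "0 \<le> p"
  obtains z :: "real ^ ('n::{finite,linorder})" where
    "\<And>t b a b' a' C. 1 \<le> t \<Longrightarrow> 0 \<le> C \<Longrightarrow>
      (\<integral>\<^sup>+x. ennreal (weight b a x * \<bar>bump z (dil (- {Max UNIV}) t x)\<bar> powr p) \<partial>lborel) \<le>
      ennreal C * (\<integral>\<^sup>+x. ennreal (weight b' a' x * norm (grad (\<lambda>x. bump z (dil (- {Max UNIV}) t x)) x) powr p) \<partial>lborel) \<Longrightarrow>
      (\<integral>\<^sup>+x. ennreal (\<bar>bump z x\<bar> powr p) \<partial>lborel) \<le>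
      ennreal (C * 8 powr (\<bar>b\<bar> + \<bar>a\<bar> + \<bar>b'\<bar> + \<bar>a'\<bar>) * t powr (a + p - a')) *
        (\<integral>\<^sup>+x. ennreal (norm (grad (bump z) x) powr p) \<partial>lborel)"
proof -
  let ?S = "- {Max UNIV} :: 'n set"
  obtain z :: "(real, 'n) vec" where
    up: "\<And>t b a x. 1 \<le> t \<Longrightarrow> norm (x - z) \<le> 1 \<Longrightarrow>
      weight b a (dil ?S (1 / t) x) \<le> 8 powr \<bar>b\<bar> * 8 powr \<bar>a\<bar> * t powr (- a)" and
    lo: "\<And>t b a x. 1 \<le> t \<Longrightarrow> norm (x - z) \<le> 1 \<Longrightarrow>
      8 powr (- \<bar>b\<bar>) * 8 powr (- \<bar>a\<bar>) * t powr (- a) \<le> weight b a (dil ?S (1 / t) x)"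
    by (rule weight_dil_bounds[OF n], rule that)
  have [measurable]: "bump z \<in> borel_measurable borel" "grad (bump z) \<in> borel_measurable borel"
    using C01_measurable[OF bump_C01] by auto
  define E where "E = (\<integral>\<^sup>+x. ennreal (\<bar>bump z x\<bar> powr p) \<partial>lborel)"
  define F where "F = (\<integral>\<^sup>+x. ennreal (norm (grad (bump z) x) powr p) \<partial>lborel)"
  have lower: "ennreal (1 / t ^ card ?S) * (ennreal (8 powr (- \<bar>b\<bar>) * 8 powr (- \<bar>a\<bar>) * t powr (- a)) * E) \<le>
      (\<integral>\<^sup>+x. ennreal (weight b a x * \<bar>bump z (dil ?S t x)\<bar> powr p) \<partial>lborel)"
    if t: "1 \<le> t" for t b a
  proof -
    have "(\<integral>\<^sup>+x. ennreal (weight b a x * \<bar>bump z (dil ?S t x)\<bar> powr p) \<partial>lborel) =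
        (\<integral>\<^sup>+x. ennreal (weight b a (dil ?S (1 / t) (dil ?S t x)) * \<bar>bump z (dil ?S t x)\<bar> powr p) \<partial>lborel)"
      using t by simp
    also have "\<dots> = ennreal (1 / t ^ card ?S) * (\<integral>\<^sup>+x. ennreal (weight b a (dil ?S (1 / t) x) * \<bar>bump z x\<bar> powr p) \<partial>lborel)"
      using t by (intro nn_integral_dil) auto
    finally have eq: "(\<integral>\<^sup>+x. ennreal (weight b a x * \<bar>bump z (dil ?S t x)\<bar> powr p) \<partial>lborel) =
        ennreal (1 / t ^ card ?S) * (\<integral>\<^sup>+x. ennreal (weight b a (dil ?S (1 / t) x) * \<bar>bump z x\<bar> powr p) \<partial>lborel)" .
    have "(\<integral>\<^sup>+x. ennreal (weight b a (dil ?S (1 / t) x) * \<bar>bump z x\<bar> powr p) \<partial>lborel) \<ge>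
        (\<integral>\<^sup>+x. ennreal (8 powr (- \<bar>b\<bar>) * 8 powr (- \<bar>a\<bar>) * t powr (- a)) * ennreal (\<bar>bump z x\<bar> powr p) \<partial>lborel)"
    proof (rule nn_integral_mono)
      fix x
      show "ennreal (8 powr (- \<bar>b\<bar>) * 8 powr (- \<bar>a\<bar>) * t powr (- a)) * ennreal (\<bar>bump z x\<bar> powr p) \<le>
          ennreal (weight b a (dil ?S (1 / t) x) * \<bar>bump z x\<bar> powr p)"
      proof (cases "bump z x = 0")
        case False
        then have "norm (x - z) \<le> 1" using bump_eq_0_iff[of z x] by simp
        then show ?thesis
          using lo[OF t, of x b a] by (simp add: ennreal_mult[symmetric] ennreal_leI mult_right_mono)
      qed simp
    qed
    then show ?thesis
      unfolding eq E_def by (intro mult_left_mono) (simp_all add: nn_integral_cmult)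
  qed
  have upper: "(\<integral>\<^sup>+x. ennreal (weight b a x * norm (grad (\<lambda>x. bump z (dil ?S t x)) x) powr p) \<partial>lborel) \<le>
      ennreal (1 / t ^ card ?S) * (ennreal (8 powr \<bar>b\<bar> * 8 powr \<bar>a\<bar> * t powr (- a) * t powr p) * F)"
    if t: "1 \<le> t" for t b a
  proof -
    have "(\<integral>\<^sup>+x. ennreal (weight b a x * norm (grad (\<lambda>x. bump z (dil ?S t x)) x) powr p) \<partial>lborel) =
        (\<integral>\<^sup>+x. ennreal (weight b a (dil ?S (1 / t) (dil ?S t x)) * norm (dil ?S t (grad (bump z) (dil ?S t x))) powr p) \<partial>lborel)"
      using t by (simp add: grad_dil(2)[OF bump_C01])
    also have "\<dots> = ennreal (1 / t ^ card ?S) * (\<integral>\<^sup>+x. ennreal (weight b a (dil ?S (1 / t) x) * norm (dil ?S t (grad (bump z) x)) powr p) \<partial>lborel)"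
      using t by (intro nn_integral_dil) auto
    finally have eq: "(\<integral>\<^sup>+x. ennreal (weight b a x * norm (grad (\<lambda>x. bump z (dil ?S t x)) x) powr p) \<partial>lborel) =
        ennreal (1 / t ^ card ?S) * (\<integral>\<^sup>+x. ennreal (weight b a (dil ?S (1 / t) x) * norm (dil ?S t (grad (bump z) x)) powr p) \<partial>lborel)" .
    have "(\<integral>\<^sup>+x. ennreal (weight b a (dil ?S (1 / t) x) * norm (dil ?S t (grad (bump z) x)) powr p) \<partial>lborel) \<le>
        (\<integral>\<^sup>+x. ennreal (8 powr \<bar>b\<bar> * 8 powr \<bar>a\<bar> * t powr (- a) * t powr p) * ennreal (norm (grad (bump z) x) powr p) \<partial>lborel)"
    proof (rule nn_integral_mono)
      fix x
      show "ennreal (weight b a (dil ?S (1 / t) x) * norm (dil ?S t (grad (bump z) x)) powr p) \<le>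
          ennreal (8 powr \<bar>b\<bar> * 8 powr \<bar>a\<bar> * t powr (- a) * t powr p) * ennreal (norm (grad (bump z) x) powr p)"
      proof (cases "norm (x - z) \<le> 1")
        case True
        have "norm (dil ?S t (grad (bump z) x)) powr p \<le> (t * norm (grad (bump z) x)) powr p"
          using p t by (intro powr_mono2 norm_dil_le) auto
        also have "\<dots> = t powr p * norm (grad (bump z) x) powr p" using t by (simp add: powr_mult)
        finally have "weight b a (dil ?S (1 / t) x) * norm (dil ?S t (grad (bump z) x)) powr p \<le>
          8 powr \<bar>b\<bar> * 8 powr \<bar>a\<bar> * t powr (- a) * (t powr p * norm (grad (bump z) x) powr p)"
          using up[OF t True, of b a] by (intro mult_mono) auto
        then show ?thesis by (simp add: ennreal_mult[symmetric] ennreal_leI mult.assoc)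
      next
        case False
        then have "grad (bump z) x = 0" by (simp add: grad_bump_eq_0)
        then show ?thesis
          by (simp add: linear_0[OF bounded_linear.linear[OF bounded_linear_dil]])
      qed
    qed
    then show ?thesis
      unfolding eq F_def by (intro mult_left_mono) (simp_all add: nn_integral_cmult)
  qed
  show ?thesis
  proof (rule that[of z], fold E_def F_def)
    fix t b a b' a' C :: real
    assume t: "1 \<le> t" and C: "0 \<le> C"
    assume le: "(\<integral>\<^sup>+x. ennreal (weight b a x * \<bar>bump z (dil ?S t x)\<bar> powr p) \<partial>lborel) \<le>
      ennreal C * (\<integral>\<^sup>+x. ennreal (weight b' a' x * norm (grad (\<lambda>x. bump z (dil ?S t x)) x) powr p) \<partial>lborel)"
    let ?k = "ennreal (1 / t ^ card ?S)"
    define c where "c = 8 powr (- \<bar>b\<bar>) * 8 powr (- \<bar>a\<bar>) * t powr (- a)"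
    define d where "d = 8 powr \<bar>b'\<bar> * 8 powr \<bar>a'\<bar> * t powr (- a') * t powr p"
    have cd: "0 < c" "0 \<le> d" using t by (auto simp: c_def d_def)
    have "?k * (ennreal c * E) \<le> ennreal C * (?k * (ennreal d * F))"
      unfolding c_def d_def
      by (rule order_trans[OF lower[OF t] order_trans[OF le mult_left_mono[OF upper[OF t]]]]) simp
    then have "?k * (ennreal c * E) \<le> ?k * (ennreal (C * d) * F)"
      using C cd by (simp add: ennreal_mult ac_simps)
    \<comment> \<open>The Jacobian, common to both sides, is positive and finite and
      cancels.\<close>
    then have "ennreal c * E \<le> ennreal (C * d) * F"
      using t by (subst (asm) ennreal_mult_le_mult_iff) auto
    then have "ennreal (1 / c) * (ennreal c * E) \<le> ennreal (1 / c) * (ennreal (C * d) * F)"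
      by (rule mult_left_mono) simp
    then have "E \<le> ennreal (1 / c * (C * d)) * F"
      using cd C by (simp add: mult.assoc[symmetric] ennreal_mult[symmetric])
    also have "1 / c * (C * d) = C * 8 powr (\<bar>b\<bar> + \<bar>a\<bar> + \<bar>b'\<bar> + \<bar>a'\<bar>) * t powr (a + p - a')"
      using t by (simp add: c_def d_def powr_add powr_diff powr_minus field_simps)
    finally show "E \<le> ennreal (C * 8 powr (\<bar>b\<bar> + \<bar>a\<bar> + \<bar>b'\<bar> + \<bar>a'\<bar>) * t powr (a + p - a')) * F" .
  qed
qed

section \<open>From the integral estimates to the inequality between norms\<close>

lemma weight_exchange_le:
  assumes "\<alpha>' \<le> \<alpha>"
  shows "weight \<beta> (\<alpha> + 1) x \<le> weight (\<beta> + \<alpha> - \<alpha>') (\<alpha>' + 1) x"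
  using weight_shift_le[of "\<alpha> - \<alpha>'" "\<beta> + \<alpha> - \<alpha>'" "\<alpha>' + 1" x] assms by (simp add: add.commute)

lemma norm_weight_scaleR_powr:
  fixes v :: "'a::real_normed_vector"
  shows "norm (weight b a x *\<^sub>R v) powr p = weight (b * p) (a * p) x * norm v powr p"
  by (simp add: powr_mult weight_powr)

theorem theorem1p3:
  fixes p \<alpha> \<beta> :: real
  assumes "2 \<le> CARD('n::{finite,linorder})"
    and "1 \<le> p" and "p < real CARD('n::{finite,linorder})"
    and "\<alpha> * p > 1 - real CARD('n::{finite,linorder})"
    and "(\<alpha> + \<beta>) * p > - real CARD('n::{finite,linorder})"
  shows "(\<exists>C::real. C > 0 \<and> (\<forall>u \<in> (C01 :: (real ^ ('n::{finite,linorder}) \<Rightarrow> real) set). \<forall>\<alpha>'\<le>\<alpha>.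
            Lp_norm p (\<lambda>x. weight \<beta> \<alpha> x *\<^sub>R u x)
              \<le> ennreal C * Lp_norm p (\<lambda>x. weight (\<beta> + \<alpha> - \<alpha>') (\<alpha>' + 1) x *\<^sub>R grad u x)))
       \<and> (\<forall>\<alpha>'>\<alpha>. \<forall>C::real. C > 0 \<longrightarrow> (\<exists>u \<in> (C01 :: (real ^ ('n::{finite,linorder}) \<Rightarrow> real) set).
            \<not> Lp_norm p (\<lambda>x. weight \<beta> \<alpha> x *\<^sub>R u x)
              \<le> ennreal C * Lp_norm p (\<lambda>x. weight (\<beta> + \<alpha> - \<alpha>') (\<alpha>' + 1) x *\<^sub>R grad u x)))"
proof (intro conjI allI impI)
  have p: "0 < p" using assms(2) by simp
  have b: "- real CARD('n) < \<alpha> * p + \<beta> * p" using assms(5) by (simp add: algebra_simps)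
  obtain K where K: "0 < K" and hardy: "\<And>u :: (real, 'n) vec \<Rightarrow> real. u \<in> C01 \<Longrightarrow>
      (\<integral>\<^sup>+x. ennreal (weight (\<beta> * p) (\<alpha> * p) x * \<bar>u x\<bar> powr p) \<partial>lborel) \<le>
      ennreal K * (\<integral>\<^sup>+x. ennreal (weight (\<beta> * p) (\<alpha> * p + p) x * norm (grad u x) powr p) \<partial>lborel)"
    by (rule weighted_hardy[OF assms(1,2,4) b], rule that)
  show "\<exists>C::real. C > 0 \<and> (\<forall>u \<in> (C01 :: ((real, 'n) vec \<Rightarrow> real) set). \<forall>\<alpha>'\<le>\<alpha>.
            Lp_norm p (\<lambda>x. weight \<beta> \<alpha> x *\<^sub>R u x)
              \<le> ennreal C * Lp_norm p (\<lambda>x. weight (\<beta> + \<alpha> - \<alpha>') (\<alpha>' + 1) x *\<^sub>R grad u x))"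
  proof (intro exI conjI ballI allI impI)
    \<comment> \<open>\<open>K\<close> bounds integrals of p-th powers, so the norms take its p-th
      root.\<close>
    show C: "0 < K powr (1 / p)" using K by simp
    fix u :: "(real, 'n) vec \<Rightarrow> real" and \<alpha>'
    assume u: "u \<in> C01" and le: "\<alpha>' \<le> \<alpha>"
    have "(\<integral>\<^sup>+x. ennreal (norm (weight \<beta> \<alpha> x *\<^sub>R u x) powr p) \<partial>lborel) \<le>
        ennreal K * (\<integral>\<^sup>+x. ennreal (norm (weight \<beta> (\<alpha> + 1) x *\<^sub>R grad u x) powr p) \<partial>lborel)"
      unfolding norm_weight_scaleR_powr using hardy[OF u] by (simp add: distrib_right)
    \<comment> \<open>Lowering \<open>\<alpha>'\<close> only enlarges the weight on the right, so
      one constant serves all \<open>\<alpha>' \<le> \<alpha>\<close>.\<close>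
    also have "\<dots> \<le> ennreal K * (\<integral>\<^sup>+x. ennreal (norm (weight (\<beta> + \<alpha> - \<alpha>') (\<alpha>' + 1) x *\<^sub>R grad u x) powr p) \<partial>lborel)"
      using p weight_exchange_le[OF le]
      by (intro mult_left_mono nn_integral_mono ennreal_leI powr_mono2) (auto intro!: mult_right_mono)
    finally show "Lp_norm p (\<lambda>x. weight \<beta> \<alpha> x *\<^sub>R u x)
        \<le> ennreal (K powr (1 / p)) * Lp_norm p (\<lambda>x. weight (\<beta> + \<alpha> - \<alpha>') (\<alpha>' + 1) x *\<^sub>R grad u x)"
      unfolding Lp_norm_le_iff[OF p C] using p K by (simp add: powr_powr)
  qed
next
  fix \<alpha>' C :: real
  assume less: "\<alpha> < \<alpha>'" and C: "0 < C"
  let ?S = "- {Max UNIV} :: 'n set"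
  have p: "0 < p" "0 \<le> p" using assms(2) by auto
  define \<gamma> where "\<gamma> = \<beta> + \<alpha> - \<alpha>'"
  obtain z :: "(real, 'n) vec" where bd: "\<And>t b a b' a' C. 1 \<le> t \<Longrightarrow> 0 \<le> C \<Longrightarrow>
      (\<integral>\<^sup>+x. ennreal (weight b a x * \<bar>bump z (dil ?S t x)\<bar> powr p) \<partial>lborel) \<le>
      ennreal C * (\<integral>\<^sup>+x. ennreal (weight b' a' x * norm (grad (\<lambda>x. bump z (dil ?S t x)) x) powr p) \<partial>lborel) \<Longrightarrow>
      (\<integral>\<^sup>+x. ennreal (\<bar>bump z x\<bar> powr p) \<partial>lborel) \<le>
      ennreal (C * 8 powr (\<bar>b\<bar> + \<bar>a\<bar> + \<bar>b'\<bar> + \<bar>a'\<bar>) * t powr (a + p - a')) *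
        (\<integral>\<^sup>+x. ennreal (norm (grad (bump z) x) powr p) \<partial>lborel)"
    by (rule concentrated_bump_bounds[OF assms(1) p(2)], rule that)
  define E where "E = (\<integral>\<^sup>+x. ennreal (\<bar>bump z x\<bar> powr p) \<partial>lborel)"
  define F where "F = (\<integral>\<^sup>+x. ennreal (norm (grad (bump z) x) powr p) \<partial>lborel)"
  obtain f where f: "F = ennreal f" "0 \<le> f"
    using bump_grad_norm_finite[OF p(2), of z] unfolding F_def[symmetric] by (cases F) auto
  define M where "M = C powr p * 8 powr (\<bar>\<beta> * p\<bar> + \<bar>\<alpha> * p\<bar> + \<bar>\<gamma> * p\<bar> + \<bar>(\<alpha>' + 1) * p\<bar>)"
  have M: "0 \<le> M" by (simp add: M_def)
  \<comment> \<open>The exponent of t equals \<open>(\<alpha> - \<alpha>') * p\<close>, which is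
    negative. For large t the bound therefore drops below the positive number
    \<open>E\<close>.\<close>
  have lim: "((\<lambda>t. ennreal (M * t powr (\<alpha> * p + p - (\<alpha>' + 1) * p) * f)) \<longlongrightarrow> ennreal (M * 0 * f)) at_top"
    using less p by (intro tendsto_intros tendsto_ennrealI tendsto_neg_powr filterlim_ident)
      (auto simp: algebra_simps)
  have "0 < E" unfolding E_def by (rule bump_norm_pos)
  then have "\<forall>\<^sub>F t in at_top. ennreal (M * t powr (\<alpha> * p + p - (\<alpha>' + 1) * p) * f) < E"
    using order_tendstoD(2)[OF lim, of E] by simp
  with eventually_ge_at_top[of 1]
  have "\<forall>\<^sub>F t in at_top. 1 \<le> t \<and> ennreal (M * t powr (\<alpha> * p + p - (\<alpha>' + 1) * p) * f) < E"
    by (rule eventually_conj)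
  then obtain t where t: "1 \<le> t" "ennreal (M * t powr (\<alpha> * p + p - (\<alpha>' + 1) * p) * f) < E"
    using eventually_happens[of _ at_top] by fastforce
  show "\<exists>u\<in>(C01 :: ((real, 'n) vec \<Rightarrow> real) set). \<not> Lp_norm p (\<lambda>x. weight \<beta> \<alpha> x *\<^sub>R u x)
      \<le> ennreal C * Lp_norm p (\<lambda>x. weight (\<beta> + \<alpha> - \<alpha>') (\<alpha>' + 1) x *\<^sub>R grad u x)"
  proof (rule bexI[of _ "\<lambda>x. bump z (dil ?S t x)"], rule notI)
    show "(\<lambda>x. bump z (dil ?S t x)) \<in> C01" by (rule C01_dil[OF bump_C01 t(1)])
    assume "Lp_norm p (\<lambda>x. weight \<beta> \<alpha> x *\<^sub>R bump z (dil ?S t x))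
      \<le> ennreal C * Lp_norm p (\<lambda>x. weight (\<beta> + \<alpha> - \<alpha>') (\<alpha>' + 1) x *\<^sub>R grad (\<lambda>x. bump z (dil ?S t x)) x)"
    then have "E \<le> ennreal (M * t powr (\<alpha> * p + p - (\<alpha>' + 1) * p)) * F"
      unfolding Lp_norm_le_iff[OF p(1) C] norm_weight_scaleR_powr
      unfolding real_norm_def E_def F_def M_def \<gamma>_def
      by (rule bd[OF t(1) powr_ge_zero])
    then show False using t(2) f M by (simp add: ennreal_mult[symmetric])
  qed
qed

end
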